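(* Let $p$ be an odd prime, let $G$ be a finite $p$-group of nilpotency class $2$ and let $w$ be a word. Then $N_{w,G}$ is a character of $G$.
   Context: A word in $k$ variables is an element $w$ of the free group on $x_1,\dots,x_k$ ($k\ge 1$). For $g_1,\dots,g_k\in G$, $w(g_1,\dots,g_k)$ is the image of $w$ under the homomorphism to $G$ with $x_i\mapsto g_i$. For $g\in G$, $N_{w,G}(g)=|\{(g_1,\dots,g_k)\in G^{k}\mid w(g_1,\dots,g_k)=g\}|$; this is a class function on $G$. "Character" means a genuine complex character, i.e. a linear combination of irreducible complex characters of $G$ with non-negative integer coefficients. *)

theory Defs
  imports
    "HOL-Algebra.Generated_Groups"
    "HOL-Computational_Algebra.Primes"
    "Jordan_Normal_Form.VS_Connect"
begin

section \<open>Free groups and word values\<close>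

text \<open>The free group on \<open>k\<close> generators is realised on freely reduced words. The
  generators are indexed by \<open>0, \<dots>, k - 1\<close>; the letter \<open>(i, True)\<close> stands for the generator
  \<open>x\<^sub>i\<close> and \<open>(i, False)\<close> for its inverse.\<close>

type_synonym letter = "nat \<times> bool"

definition letter_inv :: "letter \<Rightarrow> letter" where
  "letter_inv a = (fst a, \<not> snd a)"

definition reduced :: "letter list \<Rightarrow> bool" where
  "reduced u \<longleftrightarrow> successively (\<lambda>a b. b \<noteq> letter_inv a) u"

fun letter_mult :: "letter \<Rightarrow> letter list \<Rightarrow> letter list" where
  "letter_mult a [] = [a]"
| "letter_mult a (b # u) = (if b = letter_inv a then u else a # b # u)"

definition free_group :: "nat \<Rightarrow> letter list monoid" where
  "free_group k =
    \<lparr> carrier = {u. reduced u \<and> fst ` set u \<subseteq> {..<k}},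
      monoid.mult = (\<lambda>u v. foldr letter_mult u v),
      one = [] \<rparr>"

definition letter_value :: "('a, 'b) monoid_scheme \<Rightarrow> (nat \<Rightarrow> 'a) \<Rightarrow> letter \<Rightarrow> 'a" where
  "letter_value G g a = (if snd a then g (fst a) else inv\<^bsub>G\<^esub> (g (fst a)))"

text \<open>\<open>word_value G g w\<close> is \<open>w(g\<^sub>0, \<dots>, g\<^sub>k\<^sub>-\<^sub>1)\<close>; lemmas \<open>word_value_hom\<close>,
  \<open>word_value_generator\<close> and \<open>word_value_unique\<close> below show that it is the image of \<open>w\<close> under
  the unique homomorphism from the free group to \<open>G\<close> sending \<open>x\<^sub>i\<close> to \<open>g\<^sub>i\<close>.\<close>

definition word_value :: "('a, 'b) monoid_scheme \<Rightarrow> (nat \<Rightarrow> 'a) \<Rightarrow> letter list \<Rightarrow> 'a" where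
  "word_value G g w = foldr (\<lambda>a y. letter_value G g a \<otimes>\<^bsub>G\<^esub> y) w \<one>\<^bsub>G\<^esub>"

definition word_count ::
    "('a, 'b) monoid_scheme \<Rightarrow> nat \<Rightarrow> letter list \<Rightarrow> 'a \<Rightarrow> nat" where
  "word_count G k w g = card {gs \<in> {..<k} \<rightarrow>\<^sub>E carrier G. word_value G gs w = g}"

lemma letter_inv_inv [simp]: "letter_inv (letter_inv a) = a"
  by (simp add: letter_inv_def)

lemma fst_letter_inv [simp]: "fst (letter_inv a) = fst a"
  by (simp add: letter_inv_def)

lemma reduced_Nil [simp]: "reduced []"
  by (simp add: reduced_def)

lemma reduced_Cons:
  "reduced (a # u) \<longleftrightarrow> reduced u \<and> (u = [] \<or> hd u \<noteq> letter_inv a)"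
  by (cases u) (auto simp: reduced_def)

lemma reduced_letter_mult: "reduced u \<Longrightarrow> reduced (letter_mult a u)"
  by (cases u) (auto simp: reduced_Cons)

lemma set_letter_mult: "set (letter_mult a u) \<subseteq> insert a (set u)"
  by (cases u) auto

lemma letter_mult_cancel:
  "reduced u \<Longrightarrow> letter_mult a (letter_mult (letter_inv a) u) = u"
  by (cases u rule: remdups_adj.cases) (auto simp: reduced_Cons)

lemma reduced_mult: "reduced v \<Longrightarrow> reduced (foldr letter_mult u v)"
  by (induction u) (auto intro: reduced_letter_mult)

lemma set_mult: "set (foldr letter_mult u v) \<subseteq> set u \<union> set v"
proof (induction u)
  case (Cons a u)
  then show ?case using set_letter_mult[of a "foldr letter_mult u v"] by auto
qed simp

lemma letter_mult_mult:
  assumes "reduced v"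
  shows "foldr letter_mult (letter_mult a u) v = letter_mult a (foldr letter_mult u v)"
  using letter_mult_cancel[OF reduced_mult[OF assms]] by (cases u) auto

lemma mult_assoc:
  assumes "reduced w"
  shows "foldr letter_mult (foldr letter_mult u v) w =
         foldr letter_mult u (foldr letter_mult v w)"
  by (induction u) (simp_all add: letter_mult_mult[OF assms])

lemma mult_Nil: "reduced u \<Longrightarrow> foldr letter_mult u [] = u"
proof (induction u)
  case (Cons a u)
  then show ?case by (cases u) (auto simp: reduced_Cons)
qed simp

lemma mult_inverse:
  "foldr letter_mult (rev (map letter_inv u)) u = []"
  by (induction u) auto

lemma reduced_inverse: "reduced u \<Longrightarrow> reduced (rev (map letter_inv u))"
  unfolding reduced_def successively_rev successively_map
  by (erule successively_mono) (metis letter_inv_inv)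

lemma group_free_group: "group (free_group k)"
proof (rule groupI)
  fix u v assume "u \<in> carrier (free_group k)" "v \<in> carrier (free_group k)"
  then show "u \<otimes>\<^bsub>free_group k\<^esub> v \<in> carrier (free_group k)"
    using set_mult[of u v] by (fastforce simp: free_group_def reduced_mult)
next
  fix u assume u: "u \<in> carrier (free_group k)"
  show "\<exists>v\<in>carrier (free_group k). v \<otimes>\<^bsub>free_group k\<^esub> u = \<one>\<^bsub>free_group k\<^esub>"
    by (rule bexI[of _ "rev (map letter_inv u)"])
      (use u in \<open>auto simp: free_group_def mult_inverse reduced_inverse\<close>)
qed (auto simp: free_group_def mult_assoc)

lemma (in group) letter_value_closed:
  "g (fst a) \<in> carrier G \<Longrightarrow> letter_value G g a \<in> carrier G"
  by (simp add: letter_value_def)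

lemma (in group) word_value_closed:
  assumes "g \<in> {..<k} \<rightarrow> carrier G" "fst ` set u \<subseteq> {..<k}"
  shows "word_value G g u \<in> carrier G"
  using assms(2) by (induction u) (use assms(1) in \<open>auto simp: word_value_def letter_value_closed Pi_iff\<close>)

lemma (in group) word_value_letter_mult:
  assumes "g \<in> {..<k} \<rightarrow> carrier G" "fst ` set (a # u) \<subseteq> {..<k}"
  shows "word_value G g (letter_mult a u) = letter_value G g a \<otimes> word_value G g u"
proof (cases "u \<noteq> [] \<and> hd u = letter_inv a")
  case True
  then obtain v where v: "u = letter_inv a # v" by (cases u) auto
  have ga: "g (fst a) \<in> carrier G" using assms by auto
  have "word_value G g v \<in> carrier G"
    using word_value_closed[OF assms(1)] assms(2) v by auto
  moreover have "letter_value G g a \<otimes> letter_value G g (letter_inv a) = \<one>"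
    using ga by (auto simp: letter_value_def letter_inv_def)
  ultimately show ?thesis
    using v ga by (simp add: word_value_def letter_value_closed flip: m_assoc)
next
  case False
  then show ?thesis by (cases u) (auto simp: word_value_def)
qed

lemma (in group) word_value_hom:
  assumes "g \<in> {..<k} \<rightarrow> carrier G"
  shows "word_value G g \<in> hom (free_group k) G"
proof (rule homI)
  fix u v assume "u \<in> carrier (free_group k)" and v: "v \<in> carrier (free_group k)"
  then have "fst ` set u \<subseteq> {..<k}" by (simp add: free_group_def)
  then have "word_value G g (foldr letter_mult u v) = word_value G g u \<otimes> word_value G g v"
  proof (induction u)
    case Nil
    then show ?case
      using word_value_closed[OF assms] v by (simp add: word_value_def free_group_def)
  next
    case (Cons a u)
    have sub: "fst ` set (a # foldr letter_mult u v) \<subseteq> {..<k}"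
      using Cons.prems v set_mult[of u v] by (fastforce simp: free_group_def)
    have "letter_value G g a \<in> carrier G"
      using Cons.prems assms by (auto intro: letter_value_closed)
    moreover have "word_value G g u \<in> carrier G" "word_value G g v \<in> carrier G"
      using Cons.prems v by (auto intro!: word_value_closed[OF assms] simp: free_group_def)
    ultimately have "letter_value G g a \<otimes> (word_value G g u \<otimes> word_value G g v)
        = word_value G g (a # u) \<otimes> word_value G g v"
      by (simp add: word_value_def m_assoc)
    then show ?case
      using Cons word_value_letter_mult[OF assms sub] by simp
  qed
  then show "word_value G g (u \<otimes>\<^bsub>free_group k\<^esub> v) = word_value G g u \<otimes> word_value G g v"
    by (simp add: free_group_def)
qed (auto simp: free_group_def intro!: word_value_closed[OF assms])

lemma (in group) word_value_generator:
  "g i \<in> carrier G \<Longrightarrow> word_value G g [(i, True)] = g i"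
  by (simp add: word_value_def letter_value_def)

lemma (in group) word_value_unique:
  assumes h: "h \<in> hom (free_group k) G"
    and gen: "\<And>i. i < k \<Longrightarrow> h [(i, True)] = g i"
    and u: "u \<in> carrier (free_group k)"
  shows "h u = word_value G g u"
proof -
  interpret F: group "free_group k" by (rule group_free_group)
  interpret h: group_hom "free_group k" G h
    using h by unfold_locales
  have one: "h [] = \<one>" using h.hom_one by (simp add: free_group_def)
  have sing: "[a] \<in> carrier (free_group k)" if "fst a < k" for a
    using that by (auto simp: free_group_def reduced_Cons)
  have letter: "h [a] = letter_value G g a" if a: "fst a < k" for a
  proof (cases "snd a")
    case True
    then show ?thesis using gen[OF a] by (cases a) (simp add: letter_value_def)
  next
    case False
    have "[a] \<otimes>\<^bsub>free_group k\<^esub> [(fst a, True)] = \<one>\<^bsub>free_group k\<^esub>"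
      using False by (cases a) (simp add: free_group_def letter_inv_def)
    then have "h [a] \<otimes> h [(fst a, True)] = \<one>"
      using sing[OF a] sing[of "(fst a, True)"] a by (metis h.hom_mult h.hom_one fst_conv)
    then have "h [a] = inv (h [(fst a, True)])"
      using sing[OF a] sing[of "(fst a, True)"] a
      by (intro inv_equality[symmetric]) auto
    then show ?thesis using False gen[OF a] by (simp add: letter_value_def)
  qed
  from u have "reduced u" "fst ` set u \<subseteq> {..<k}" by (auto simp: free_group_def)
  then show ?thesis
  proof (induction u)
    case Nil
    then show ?case by (simp add: one word_value_def)
  next
    case (Cons a u)
    have c: "u \<in> carrier (free_group k)" and a: "fst a < k"
      using Cons.prems by (auto simp: free_group_def reduced_Cons)
    have "[a] \<otimes>\<^bsub>free_group k\<^esub> u = a # u"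
      using Cons.prems by (cases u) (auto simp: free_group_def reduced_Cons)
    then have "h (a # u) = h [a] \<otimes> h u"
      using h.hom_mult[OF sing[OF a] c] by simp
    then show ?case
      using Cons a letter by (simp add: word_value_def reduced_Cons)
  qed
qed

section \<open>Nilpotency class\<close>

text \<open>Indexed from zero: \<open>lower_central G n\<close> is the term usually written \<open>\<gamma>\<^sub>n\<^sub>+\<^sub>1(G)\<close>.\<close>

primrec lower_central :: "('a, 'b) monoid_scheme \<Rightarrow> nat \<Rightarrow> 'a set" where
  "lower_central G 0 = carrier G"
| "lower_central G (Suc n) = generate G
     (\<Union>x \<in> lower_central G n. \<Union>y \<in> carrier G.
       {x \<otimes>\<^bsub>G\<^esub> y \<otimes>\<^bsub>G\<^esub> inv\<^bsub>G\<^esub> x \<otimes>\<^bsub>G\<^esub> inv\<^bsub>G\<^esub> y})"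

definition has_nilpotency_class :: "('a, 'b) monoid_scheme \<Rightarrow> nat \<Rightarrow> bool" where
  "has_nilpotency_class G c \<longleftrightarrow>
     lower_central G c = {\<one>\<^bsub>G\<^esub>} \<and> (\<forall>d<c. lower_central G d \<noteq> {\<one>\<^bsub>G\<^esub>})"

section \<open>Complex characters\<close>

definition mat_trace :: "complex mat \<Rightarrow> complex" where
  "mat_trace A = (\<Sum>i<dim_row A. A $$ (i, i))"

text \<open>The codomain is \<open>GL\<^sub>n(\<complex>)\<close>.\<close>

definition representation ::
    "('a, 'b) monoid_scheme \<Rightarrow> nat \<Rightarrow> ('a \<Rightarrow> complex mat) \<Rightarrow> bool" where
  "representation G n \<rho> \<longleftrightarrow> \<rho> \<in> hom G (units_of (ring_mat TYPE(complex) n ()))"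

definition irreducible_representation ::
    "('a, 'b) monoid_scheme \<Rightarrow> nat \<Rightarrow> ('a \<Rightarrow> complex mat) \<Rightarrow> bool" where
  "irreducible_representation G n \<rho> \<longleftrightarrow> representation G n \<rho> \<and> n > 0 \<and>
     (\<forall>W. subspace class_ring W (module_vec TYPE(complex) n) \<longrightarrow>
        (\<forall>g\<in>carrier G. \<forall>v\<in>W. \<rho> g *\<^sub>v v \<in> W) \<longrightarrow>
        W = {0\<^sub>v n} \<or> W = carrier_vec n)"

text \<open>Characters are restricted to the carrier so that each irreducible character is a single
  element of this set.\<close>

definition irr_characters :: "('a, 'b) monoid_scheme \<Rightarrow> ('a \<Rightarrow> complex) set" where
  "irr_characters G =
     {\<lambda>g\<in>carrier G. mat_trace (\<rho> g) | n \<rho>. irreducible_representation G n \<rho>}"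

text \<open>The set \<open>S\<close> carries the nonzero coefficients; taking it finite avoids depending on the
  finiteness of \<open>irr_characters G\<close>, and values of \<open>f\<close> outside the carrier are irrelevant.\<close>

definition is_character :: "('a, 'b) monoid_scheme \<Rightarrow> ('a \<Rightarrow> complex) \<Rightarrow> bool" where
  "is_character G f \<longleftrightarrow>
     (\<exists>S (c :: ('a \<Rightarrow> complex) \<Rightarrow> nat). finite S \<and> S \<subseteq> irr_characters G \<and>
        (\<forall>g\<in>carrier G. f g = (\<Sum>\<chi>\<in>S. of_nat (c \<chi>) * \<chi> g)))"

end

theory Submission
  imports Defs "HOL-Number_Theory.Cong" "HOL-Algebra.Multiplicative_Group"
begin

text \<open>The proof is Kirillov's orbit method. By the Baer correspondence \<open>G\<close> carries an abelian group
  structure \<open>x + y = x y [y, x]\<^sup>1\<^sup>/\<^sup>2\<close>. Let \<open>\<nu>\<close> be a linear character of it. Then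
  \<open>\<nu>([x, y])\<close> is an alternating bicharacter, with radical \<open>R\<close> say, and \<open>\<nu>\<close> restricted to a maximal
  isotropic subgroup induces to an irreducible character of \<open>G\<close>, which equals \<open>d \<nu>\<close> on \<open>R\<close> and
  vanishes off \<open>R\<close>, where \<open>d\<^sup>2 = |G : R|\<close>. Averaging the Fourier expansion of the class function
  \<open>N\<^sub>w\<close> over conjugation shows that this character has multiplicity \<open>d c\<close>, where \<open>c\<close> is the Fourier
  coefficient of \<open>N\<^sub>w\<close> at \<open>\<nu>\<close>. Finally \<open>c\<close> is a nonnegative integer:
  \<open>|G| c\<close> is the sum of
  \<open>\<nu>(w(g))\<^sup>-\<^sup>1\<close> over all tuples \<open>g\<close>, and the exponent is a linear plus an alternating form in \<open>g\<close>. After a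
  linear change of variables the linear part involves only the first variable; summing over the
  other variables yields, by induction, a multiple of the indicator function of a subgroup, and a
  linear character summed over a subgroup is \<open>0\<close> or the order of the subgroup.\<close>

section \<open>Linear characters of finite abelian groups\<close>

definition linear_character :: "('a, 'b) monoid_scheme \<Rightarrow> ('a \<Rightarrow> complex) \<Rightarrow> bool" where
  "linear_character G \<chi> \<longleftrightarrow> \<chi> \<one>\<^bsub>G\<^esub> = 1 \<and>
     (\<forall>x\<in>carrier G. \<forall>y\<in>carrier G. \<chi> (x \<otimes>\<^bsub>G\<^esub> y) = \<chi> x * \<chi> y)"

text \<open>Extensionality makes each homomorphism a single function, so that the set is finite and
  a sum over it meets every character once.\<close>

definition linear_characters :: "('a, 'b) monoid_scheme \<Rightarrow> ('a \<Rightarrow> complex) set" where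
  "linear_characters G = {\<chi> \<in> extensional (carrier G). linear_character G \<chi>}"

lemma linear_character_one: "linear_character G \<chi> \<Longrightarrow> \<chi> \<one>\<^bsub>G\<^esub> = 1"
  by (simp add: linear_character_def)

lemma linear_character_mult:
  "linear_character G \<chi> \<Longrightarrow> x \<in> carrier G \<Longrightarrow> y \<in> carrier G \<Longrightarrow>
     \<chi> (x \<otimes>\<^bsub>G\<^esub> y) = \<chi> x * \<chi> y"
  by (simp add: linear_character_def)

lemma linear_character_times:
  "linear_character G \<chi> \<Longrightarrow> linear_character G \<psi> \<Longrightarrow> linear_character G (\<lambda>x. \<chi> x * \<psi> x)"
  by (simp add: linear_character_def)

lemma linear_character_inverse:
  "linear_character G \<chi> \<Longrightarrow> linear_character G (\<lambda>x. inverse (\<chi> x))"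
  by (simp add: linear_character_def)

lemma (in group) linear_character_pow:
  assumes "linear_character G \<chi>" "x \<in> carrier G"
  shows "\<chi> (x [^] (n::nat)) = \<chi> x ^ n"
  using assms by (induction n) (auto simp: linear_character_one linear_character_mult)

lemma (in group) linear_character_nonzero:
  assumes "linear_character G \<chi>" "x \<in> carrier G"
  shows "\<chi> x \<noteq> 0"
proof
  assume "\<chi> x = 0"
  moreover have "\<chi> (x \<otimes> inv x) = \<chi> x * \<chi> (inv x)"
    using assms by (intro linear_character_mult) auto
  ultimately show False using assms by (simp add: linear_character_one)
qed

lemma (in group) linear_character_inv:
  assumes "linear_character G \<chi>" "x \<in> carrier G"
  shows "\<chi> (inv x) = inverse (\<chi> x)"
proof -
  have "\<chi> (x \<otimes> inv x) = \<chi> x * \<chi> (inv x)"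
    using assms by (intro linear_character_mult) auto
  then have "\<chi> x * \<chi> (inv x) = 1" using assms by (simp add: linear_character_one)
  then show ?thesis by (metis inverse_unique)
qed

lemma (in group) linear_character_power_card:
  assumes "linear_character G \<chi>" "x \<in> carrier G"
  shows "\<chi> x ^ card (carrier G) = 1"
  using linear_character_pow[OF assms, of "card (carrier G)"] pow_order_eq_1[of x] assms
  by (simp add: Coset.order_def linear_character_one)

lemma (in group) finite_linear_characters:
  assumes "finite (carrier G)"
  shows "finite (linear_characters G)"
proof (rule finite_subset)
  show "linear_characters G \<subseteq> carrier G \<rightarrow>\<^sub>E {z. z ^ card (carrier G) = 1}"
    by (auto simp: linear_characters_def linear_character_power_card extensional_def)
  have "card (carrier G) \<ge> 1"
    using assms one_closed by (metis One_nat_def Suc_leI card_gt_0_iff empty_iff)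
  then show "finite (carrier G \<rightarrow>\<^sub>E {z::complex. z ^ card (carrier G) = 1})"
    using assms by (intro finite_PiE finite_roots_unity) auto
qed

text \<open>If \<open>\<chi> h\<close> differs from 1, translation by \<open>h\<close> permutes
  \<open>H\<close> and multiplies the sum by \<open>\<chi> h\<close>, so the sum vanishes.
  Multiplicativity is asked on \<open>H\<close> only, since some functions summed later are known to
  be multiplicative there alone.\<close>

lemma (in group) sum_linear_character:
  fixes \<chi> :: "'a \<Rightarrow> complex"
  assumes H: "subgroup H G"
    and mult: "\<And>x y. x \<in> H \<Longrightarrow> y \<in> H \<Longrightarrow> \<chi> (x \<otimes> y) = \<chi> x * \<chi> y"
  shows "(\<Sum>x\<in>H. \<chi> x) = (if \<forall>x\<in>H. \<chi> x = 1 then of_nat (card H) else 0)"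
proof (cases "\<forall>x\<in>H. \<chi> x = 1")
  case False
  then obtain h where h: "h \<in> H" "\<chi> h \<noteq> 1" by auto
  interpret H: subgroup H G by (rule H)
  have "(\<Sum>x\<in>H. \<chi> x) = (\<Sum>x\<in>H. \<chi> (h \<otimes> x))"
    by (rule sum.reindex_bij_witness[of _ "\<lambda>x. h \<otimes> x" "\<lambda>x. inv h \<otimes> x"])
      (use h in \<open>auto simp flip: m_assoc\<close>)
  also have "\<dots> = \<chi> h * (\<Sum>x\<in>H. \<chi> x)"
    by (simp add: mult h sum_distrib_left)
  finally have "(1 - \<chi> h) * (\<Sum>x\<in>H. \<chi> x) = 0" by (simp add: algebra_simps)
  then show ?thesis using h False by auto
qed simp

lemma (in group) linear_characters_eqI:
  assumes "\<chi> \<in> linear_characters G" "\<psi> \<in> linear_characters G"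
    and "\<And>x. x \<in> carrier G \<Longrightarrow> \<chi> x = \<psi> x"
  shows "\<chi> = \<psi>"
  using assms unfolding linear_characters_def by (auto intro: extensionalityI)

lemma (in group) linear_characters_orthogonal:
  assumes "\<chi> \<in> linear_characters G" "\<psi> \<in> linear_characters G"
  shows "(\<Sum>x\<in>carrier G. \<chi> x * inverse (\<psi> x)) = (if \<chi> = \<psi> then of_nat (card (carrier G)) else 0)"
proof -
  have l: "linear_character G \<chi>" "linear_character G \<psi>"
    using assms by (auto simp: linear_characters_def)
  have "(\<forall>x\<in>carrier G. \<chi> x * inverse (\<psi> x) = 1) \<longleftrightarrow> \<chi> = \<psi>"
  proof
    assume "\<forall>x\<in>carrier G. \<chi> x * inverse (\<psi> x) = 1"
    then show "\<chi> = \<psi>"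
      using linear_character_nonzero[OF l(2)]
      by (intro linear_characters_eqI[OF assms]) (auto simp: field_simps)
  qed (use linear_character_nonzero[OF l(2)] in auto)
  then show ?thesis
    using l by (subst sum_linear_character[OF subgroup_self]) (auto simp: linear_character_def)
qed

section \<open>Fourier expansion on a finite abelian group\<close>

lemma root_of_unity_inverse:
  assumes "z ^ n = (1::complex)" "n > 0"
  shows "inverse z = z ^ (n - 1)"
proof -
  have "z * z ^ (n - 1) = 1" using assms by (simp flip: power_Suc)
  then show ?thesis by (rule inverse_unique)
qed

text \<open>Multiplication by a primitive root \<open>w\<close> permutes the roots of unity and
  multiplies the sum by \<open>w ^ i\<close>, which is not 1 for 0 < i < n. This makes the
  eigencomponents in the next lemma add up to the given function.\<close>

lemma sum_root_unity_powers:
  assumes "i < n"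
  shows "(\<Sum>z | z ^ n = (1::complex). z ^ i) = (if i = 0 then of_nat n else 0)"
proof (cases "i = 0")
  case True
  then show ?thesis using assms by (simp add: card_roots_unity_eq)
next
  case False
  define w where "w = cis (2 * pi / n)"
  have wn: "w ^ n = 1" and w0: "w \<noteq> 0" using assms by (simp_all add: w_def DeMoivre)
  have inj: "inj_on (\<lambda>k. cis (2 * pi * real k / real n)) {..<n}"
    using bij_betw_roots_unity[of n] assms by (auto simp: bij_betw_def)
  have "w ^ i \<noteq> 1"
  proof
    assume "w ^ i = 1"
    then have "cis (2 * pi * real i / real n) = cis (2 * pi * real 0 / real n)"
      by (simp add: w_def DeMoivre mult_ac)
    then show False using inj_onD[OF inj, of i 0] assms False by auto
  qed
  have "(\<Sum>z | z ^ n = (1::complex). z ^ i) = (\<Sum>z | z ^ n = (1::complex). (w * z) ^ i)"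
    by (rule sum.reindex_bij_witness[of _ "\<lambda>z. w * z" "\<lambda>z. inverse w * z"])
      (use wn w0 in \<open>auto simp: power_mult_distrib power_inverse\<close>)
  also have "\<dots> = w ^ i * (\<Sum>z | z ^ n = (1::complex). z ^ i)"
    by (simp add: power_mult_distrib sum_distrib_left)
  finally have "(1 - w ^ i) * (\<Sum>z | z ^ n = (1::complex). z ^ i) = 0"
    by (simp add: algebra_simps)
  with \<open>w ^ i \<noteq> 1\<close> False show ?thesis by auto
qed

text \<open>Splitting \<open>f\<close> successively into eigenfunctions of the commuting translations ends with
  common eigenfunctions, and these are multiples of linear characters.\<close>

lemma (in comm_group) linear_characters_span:
  fixes f :: "'a \<Rightarrow> complex"
  assumes fin: "finite (carrier G)"
  shows "\<exists>c. \<forall>x\<in>carrier G. f x = (\<Sum>\<chi>\<in>linear_characters G. c \<chi> * \<chi> x)"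
proof -
  let ?n = "card (carrier G)" and ?X = "linear_characters G"
  have finX: "finite ?X" by (rule finite_linear_characters[OF fin])
  have n0: "?n > 0" using fin one_closed by (metis card_gt_0_iff empty_iff)
  \<comment> \<open>Induction on a set \<open>Y\<close> outside which every translation multiplies
    \<open>f\<close> by a scalar: \<open>Y\<close> is the whole group for arbitrary \<open>f\<close>
    and empty for a common eigenfunction.\<close>
  have "\<exists>c. \<forall>x\<in>carrier G. f x = (\<Sum>\<chi>\<in>?X. c \<chi> * \<chi> x)"
    if "finite Y" "Y \<subseteq> carrier G"
      "\<forall>y\<in>carrier G - Y. \<exists>a. \<forall>z\<in>carrier G. f (y \<otimes> z) = a * f z" for Y and f :: "'a \<Rightarrow> complex"
    using that
  proof (induction Y arbitrary: f rule: finite_induct)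
    case empty
    show ?case
    proof (cases "f \<one> = 0")
      case True
      have "f x = 0" if "x \<in> carrier G" for x
        using empty.prems(2) that True by (metis Diff_empty mult_zero_right one_closed r_one)
      then show ?thesis by (intro exI[of _ "\<lambda>_. 0"]) simp
    next
      case False
      define \<psi> where "\<psi> = (\<lambda>x\<in>carrier G. f x / f \<one>)"
      have "\<psi> (x \<otimes> y) = \<psi> x * \<psi> y" if xy: "x \<in> carrier G" "y \<in> carrier G" for x y
      proof -
        obtain a where a: "\<And>z. z \<in> carrier G \<Longrightarrow> f (x \<otimes> z) = a * f z"
          using empty.prems(2) xy by (metis Diff_empty)
        then have "f x = a * f \<one>" using a[of \<one>] xy by simp
        then show ?thesis using a[of y] xy False by (simp add: \<psi>_def)
      qed
      then have "\<psi> \<in> ?X"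
        using False by (auto simp: linear_characters_def linear_character_def \<psi>_def)
      then have "(\<Sum>\<chi>\<in>?X. (if \<chi> = \<psi> then f \<one> else 0) * \<chi> x) = f \<one> * \<psi> x" for x
        using finX by (simp add: if_distrib[of "\<lambda>u. u * _"] cong: if_cong)
      moreover have "f x = f \<one> * \<psi> x" if "x \<in> carrier G" for x
        using that False by (simp add: \<psi>_def)
      ultimately show ?thesis by (intro exI[of _ "\<lambda>\<chi>. if \<chi> = \<psi> then f \<one> else 0"]) metis
    qed
  next
    case (insert x Y)
    have x: "x \<in> carrier G" using insert.prems by auto
    let ?Z = "{z::complex. z ^ ?n = 1}"
    \<comment> \<open>\<open>F z\<close> is the component of \<open>f\<close> on which translation
      by \<open>x\<close> acts as \<open>inverse z\<close>; summed over all \<open>z\<close>, these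
      components give back \<open>f\<close>.\<close>
    define F where "F = (\<lambda>z y. (\<Sum>i<?n. z ^ i * f (x [^] i \<otimes> y)) / of_nat ?n)"
    have "\<exists>c. \<forall>y\<in>carrier G. F z y = (\<Sum>\<chi>\<in>?X. c \<chi> * \<chi> y)" if z: "z \<in> ?Z" for z
    proof (rule insert.IH)
      show "\<forall>y\<in>carrier G - Y. \<exists>a. \<forall>u\<in>carrier G. F z (y \<otimes> u) = a * F z u"
      proof
        fix y assume y: "y \<in> carrier G - Y"
        show "\<exists>a. \<forall>u\<in>carrier G. F z (y \<otimes> u) = a * F z u"
        proof (cases "y = x")
          case True
          have z0: "z \<noteq> 0" using z n0 by (auto simp: power_0_left)
          have "F z (x \<otimes> u) = inverse z * F z u" if u: "u \<in> carrier G" for u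
          proof -
            define g where "g i = z ^ i * f (x [^] i \<otimes> u)" for i
            have "z * (z ^ i * f (x [^] i \<otimes> (x \<otimes> u))) = g (Suc i)" for i
              using x u by (simp add: g_def m_assoc)
            then have "z * (\<Sum>i<?n. z ^ i * f (x [^] i \<otimes> (x \<otimes> u))) = (\<Sum>i<?n. g (Suc i))"
              by (simp add: sum_distrib_left)
            \<comment> \<open>The shift affects only the end terms \<open>g ?n\<close> and
              \<open>g 0\<close>, which agree because the powers of \<open>z\<close> and of
              \<open>x\<close> with exponent \<open>?n\<close> are trivial.\<close>
            also have "\<dots> = (\<Sum>i<Suc ?n. g i) - g 0" by (simp only: sum.lessThan_Suc_shift) simp
            also have "\<dots> = (\<Sum>i<?n. g i)"
              using z x u pow_order_eq_1[of x] by (simp add: g_def Coset.order_def)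
            finally have "z * (\<Sum>i<?n. z ^ i * f (x [^] i \<otimes> (x \<otimes> u))) = (\<Sum>i<?n. g i)" .
            then have "(\<Sum>i<?n. z ^ i * f (x [^] i \<otimes> (x \<otimes> u))) = inverse z * (\<Sum>i<?n. g i)"
              using z0 by (simp only: nonzero_eq_divide_eq[OF z0] divide_inverse_commute[symmetric] mult.commute[of z])
            then show ?thesis by (simp add: F_def g_def)
          qed
          then show ?thesis using True by blast
        next
          case False
          then have "y \<in> carrier G - insert x Y" using y by auto
          then obtain a where a: "\<And>u. u \<in> carrier G \<Longrightarrow> f (y \<otimes> u) = a * f u"
            using insert.prems(2) by blast
          have "F z (y \<otimes> u) = a * F z u" if u: "u \<in> carrier G" for u
          proof -
            have "f (x [^] i \<otimes> (y \<otimes> u)) = a * f (x [^] i \<otimes> u)" for i :: nat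
            proof -
              have "x [^] i \<otimes> (y \<otimes> u) = y \<otimes> (x [^] i \<otimes> u)"
                using x y u by (simp add: m_lcomm)
              then show ?thesis using a[of "x [^] i \<otimes> u"] x u by simp
            qed
            then show ?thesis by (simp add: F_def sum_distrib_left mult_ac)
          qed
          then show ?thesis by blast
        qed
      qed
    qed (use insert.prems in auto)
    then have "\<forall>z\<in>?Z. \<exists>c. \<forall>y\<in>carrier G. F z y = (\<Sum>\<chi>\<in>?X. c \<chi> * \<chi> y)" by blast
    then obtain c where c: "\<forall>z\<in>?Z. \<forall>y\<in>carrier G. F z y = (\<Sum>\<chi>\<in>?X. c z \<chi> * \<chi> y)"
      using bchoice[of ?Z "\<lambda>z c. \<forall>y\<in>carrier G. F z y = (\<Sum>\<chi>\<in>?X. c \<chi> * \<chi> y)"] by blast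
    have "f y = (\<Sum>\<chi>\<in>?X. (\<Sum>z\<in>?Z. c z \<chi>) * \<chi> y)" if y: "y \<in> carrier G" for y
    proof -
      have "(\<Sum>z\<in>?Z. F z y) = (\<Sum>z\<in>?Z. \<Sum>i<?n. z ^ i * f (x [^] i \<otimes> y)) / of_nat ?n"
        by (simp only: F_def sum_divide_distrib[symmetric])
      moreover have "(\<Sum>z\<in>?Z. \<Sum>i<?n. z ^ i * f (x [^] i \<otimes> y))
          = (\<Sum>i<?n. (\<Sum>z\<in>?Z. z ^ i) * f (x [^] i \<otimes> y))"
        by (subst sum.swap) (simp only: sum_distrib_right)
      moreover have "\<dots> = (\<Sum>i<?n. if i = 0 then of_nat ?n * f y else 0)"
        using y by (intro sum.cong refl) (simp add: sum_root_unity_powers)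
      moreover have "\<dots> = of_nat ?n * f y" using n0 by simp
      ultimately have "(\<Sum>z\<in>?Z. F z y) = f y" using n0 by simp
      then have "f y = (\<Sum>z\<in>?Z. \<Sum>\<chi>\<in>?X. c z \<chi> * \<chi> y)" using c y by simp
      then show ?thesis by (subst (asm) sum.swap) (simp add: sum_distrib_right)
    qed
    then show ?case by (intro exI[of _ "\<lambda>\<chi>. \<Sum>z\<in>?Z. c z \<chi>"]) blast
  qed
  from this[OF fin subset_refl] show ?thesis by simp
qed

text \<open>Some expansion exists because linear characters span; orthogonality identifies its
  coefficients.\<close>

lemma (in comm_group) fourier_inversion:
  fixes f :: "'a \<Rightarrow> complex"
  assumes fin: "finite (carrier G)" and x: "x \<in> carrier G"
  shows "f x = (\<Sum>\<chi>\<in>linear_characters G.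
           (\<Sum>y\<in>carrier G. f y * inverse (\<chi> y)) / of_nat (card (carrier G)) * \<chi> x)"
proof -
  let ?X = "linear_characters G"
  have finX: "finite ?X" by (rule finite_linear_characters[OF fin])
  have n0: "card (carrier G) > 0" using fin one_closed by (metis card_gt_0_iff empty_iff)
  obtain c where c: "\<And>x. x \<in> carrier G \<Longrightarrow> f x = (\<Sum>\<chi>\<in>?X. c \<chi> * \<chi> x)"
    using linear_characters_span[OF fin, of f] by blast
  have "(\<Sum>y\<in>carrier G. f y * inverse (\<chi> y)) = of_nat (card (carrier G)) * c \<chi>" if \<chi>: "\<chi> \<in> ?X" for \<chi>
  proof -
    have "(\<Sum>y\<in>carrier G. f y * inverse (\<chi> y))
        = (\<Sum>y\<in>carrier G. \<Sum>\<psi>\<in>?X. c \<psi> * (\<psi> y * inverse (\<chi> y)))"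
      by (simp add: c sum_distrib_right mult.assoc)
    also have "\<dots> = (\<Sum>\<psi>\<in>?X. c \<psi> * (\<Sum>y\<in>carrier G. \<psi> y * inverse (\<chi> y)))"
      by (subst sum.swap) (simp add: sum_distrib_left)
    also have "\<dots> = (\<Sum>\<psi>\<in>?X. if \<psi> = \<chi> then of_nat (card (carrier G)) * c \<chi> else 0)"
      using \<chi> by (intro sum.cong refl) (simp add: linear_characters_orthogonal)
    finally show ?thesis using finX \<chi> by simp
  qed
  then show ?thesis using c[OF x] n0 by simp
qed

text \<open>This is Fourier inversion for the indicator function of the identity.\<close>

lemma (in comm_group) sum_linear_characters_eq:
  assumes fin: "finite (carrier G)" and x: "x \<in> carrier G"
  shows "(\<Sum>\<chi>\<in>linear_characters G. \<chi> x) = (if x = \<one> then of_nat (card (carrier G)) else 0)"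
proof -
  have n0: "card (carrier G) > 0" using fin one_closed by (metis card_gt_0_iff empty_iff)
  have "(\<Sum>y\<in>carrier G. (if y = \<one> then 1 else 0) * inverse (\<chi> y)) = 1"
    if "\<chi> \<in> linear_characters G" for \<chi> :: "'a \<Rightarrow> complex"
    using fin that by (simp add: if_distrib[of "\<lambda>u. u * _"] linear_characters_def linear_character_def cong: if_cong)
  then have "(if x = \<one> then 1 else 0) = (\<Sum>\<chi>\<in>linear_characters G. \<chi> x) / of_nat (card (carrier G))"
    using fourier_inversion[OF fin x, of "\<lambda>y. if y = \<one> then 1 else 0"]
    by (simp add: sum_divide_distrib)
  then show ?thesis using n0 by (auto simp: field_simps split: if_splits)
qed

section \<open>Exponential sums of alternating bicharacters\<close>

lemma (in comm_group) linear_character_finprod: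
  assumes "linear_character G \<chi>" "finite A" "f \<in> A \<rightarrow> carrier G"
  shows "\<chi> (finprod G f A) = (\<Prod>x\<in>A. \<chi> (f x))"
  using assms(2,3)
  by (induction A) (auto simp: linear_character_one[OF assms(1)] linear_character_mult[OF assms(1)])

text \<open>The divisors of a prime power form a chain under divisibility. Hence among finitely many
  coefficients there is one that divides all others modulo \<open>p ^ e\<close>.\<close>

lemma gcd_dvd_prime_power:
  fixes p :: nat
  assumes "prime p" "gcd a (p ^ e) \<le> gcd b (p ^ e)"
  shows "gcd a (p ^ e) dvd b"
proof -
  obtain i j where ij: "gcd a (p ^ e) = p ^ i" "gcd b (p ^ e) = p ^ j"
    using divides_primepow_nat[OF assms(1)] by (metis gcd_dvd2)
  then have "i \<le> j" using assms prime_gt_1_nat by (metis power_le_imp_le_exp)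
  then have "p ^ i dvd p ^ j" by (rule le_imp_power_dvd)
  then show ?thesis using ij by (metis dvd_trans gcd_dvd1)
qed

text \<open>The exponent is a linear form in the variable with the least \<open>p\<close>-adic coefficient after a
  linear substitution; the form pairing that variable with the others takes the place of the
  linear form in the next step.\<close>

lemma (in comm_group) sum_alternating_bicharacter:
  fixes \<beta> :: "'a \<Rightarrow> 'a \<Rightarrow> complex" and l :: "'i \<Rightarrow> nat" and a :: "'i \<Rightarrow> 'i \<Rightarrow> nat"
  assumes fin: "finite (carrier G)" and p: "prime p" and card: "card (carrier G) = p ^ e"
    and left: "\<And>y. y \<in> carrier G \<Longrightarrow> linear_character G (\<lambda>x. \<beta> x y)"
    and right: "\<And>x. x \<in> carrier G \<Longrightarrow> linear_character G (\<beta> x)"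
    and alt: "\<And>x. x \<in> carrier G \<Longrightarrow> \<beta> x x = 1"
    and "finite I"
  shows "\<exists>C K. K \<subseteq> carrier G \<and> (I = {} \<and> K = {} \<or> card (carrier G) dvd C) \<and>
     (\<forall>\<theta>. linear_character G \<theta> \<longrightarrow>
       (\<Sum>g\<in>I \<rightarrow>\<^sub>E carrier G. (\<Prod>i\<in>I. \<theta> (g i) ^ l i) * (\<Prod>i\<in>I. \<Prod>j\<in>I. \<beta> (g i) (g j) ^ a i j))
         = (if \<forall>x\<in>K. \<theta> x = 1 then of_nat C else 0))"
  using \<open>finite I\<close>
\<comment> \<open>The induction hypothesis is applied to all characters \<open>\<beta> h\<close> at
  once, so \<open>C\<close> and \<open>K\<close> are chosen before \<open>\<theta>\<close>. The
  exponents \<open>l\<close> and \<open>a\<close> vary because the substitution changes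
  them.\<close>
proof (induction I arbitrary: l a rule: finite_psubset_induct)
  case (psubset I)
  show ?case
  proof (cases "I = {}")
    case True
    \<comment> \<open>The sum over the single empty tuple is 1; the first alternative of the
      divisibility claim covers this case.\<close>
    then show ?thesis by (intro exI[of _ 1] exI[of _ "{}"]) simp
  next
    case False
    define n where "n = card (carrier G)"
    have n0: "n > 0" unfolding n_def using fin one_closed by (metis card_gt_0_iff empty_iff)
    obtain j where j: "j \<in> I" and min: "\<And>i. i \<in> I \<Longrightarrow> gcd (l j) n \<le> gcd (l i) n"
      using ex_has_least_nat[of "\<lambda>i. i \<in> I" _ "\<lambda>i. gcd (l i) n"] False by blast
    have "\<exists>c. [l j * c = l i] (mod n)" if "i \<in> I" for i
      using cong_solve_dvd_nat[of "l j" n "l i"] gcd_dvd_prime_power[OF p] min[OF that] card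
      by (simp add: n_def)
    then obtain c where c: "\<And>i. i \<in> I \<Longrightarrow> [l j * c i = l i] (mod n)" by metis
    \<comment> \<open>Exponents are natural numbers, so \<open>n - 1\<close> stands for -1 modulo
      \<open>n\<close>. Replacing the variable \<open>j\<close> by \<open>h \<otimes> P g\<close>,
      with exponents \<open>c' i\<close> in \<open>P g\<close>, cancels the linear terms of all
      other variables.\<close>
    define c' where "c' i = (n - 1) * c i" for i
    have c': "n dvd c' i * l j + l i" if "i \<in> I" for i
    proof -
      have "[c' i * l j + l i = c' i * l j + l j * c i] (mod n)"
        using c[OF that] by (intro cong_add cong_refl) (rule cong_sym)
      also have "c' i * l j + l j * c i = n * (l j * c i)"
        using n0 by (simp add: c'_def algebra_simps)
      finally show ?thesis by (metis cong_dvd_iff dvd_triv_left)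
    qed
    define J where "J = I - {j}"
    have J: "J \<subset> I" "finite J" "j \<notin> J" and I: "I = insert j J"
      using j psubset.hyps by (auto simp: J_def)
    \<comment> \<open>By antisymmetry the two pairings of \<open>h\<close> with \<open>g i\<close>
      combine into one power with exponent \<open>a j i - a i j\<close>; for fixed \<open>h\<close>
      this is the linear part of the remaining sum. The additional terms in \<open>a'\<close> come
      from pairing \<open>P g\<close> with the other variables.\<close>
    define l' where "l' i = a j i + (n - 1) * a i j" for i
    define a' where "a' i k = a i k + c' i * l' k" for i k
    obtain C K where K: "K \<subseteq> carrier G" and C: "J = {} \<and> K = {} \<or> card (carrier G) dvd C"
      and CK: "\<And>\<theta>. linear_character G \<theta> \<Longrightarrow>
       (\<Sum>g\<in>J \<rightarrow>\<^sub>E carrier G. (\<Prod>i\<in>J. \<theta> (g i) ^ l' i) * (\<Prod>i\<in>J. \<Prod>k\<in>J. \<beta> (g i) (g k) ^ a' i k))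
         = (if \<forall>x\<in>K. \<theta> x = 1 then of_nat C else 0)"
      using psubset.IH[OF J(1), of l' a'] by auto
    \<comment> \<open>By the induction hypothesis for \<open>\<beta> h\<close>, the inner sum over
      \<open>J\<close> is \<open>C\<close> when \<open>h\<close> lies in this annihilator of
      \<open>K\<close>, and 0 otherwise.\<close>
    define K1 where "K1 = {h \<in> carrier G. \<forall>x\<in>K. \<beta> h x = 1}"
    have K1: "subgroup K1 G"
      using K left by (intro subgroupI)
        (auto simp: K1_def subset_iff linear_character_inv[OF left]
          linear_character_mult[OF left] dest: linear_character_one[OF left] intro: exI[of _ \<one>])
    have power_n: "\<chi> x ^ m = 1" if "linear_character G \<chi>" "x \<in> carrier G" "n dvd m" for \<chi> x m
      using that linear_character_power_card[OF that(1,2)] by (auto simp: n_def power_mult)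
    have power_n1: "\<chi> x ^ (n - 1) = inverse (\<chi> x)" if "linear_character G \<chi>" "x \<in> carrier G" for \<chi> x
      using root_of_unity_inverse[OF power_n[OF that dvd_refl] n0] by simp
    have anti: "\<beta> y x = \<beta> x y ^ (n - 1)" if "x \<in> carrier G" "y \<in> carrier G" for x y
    proof -
      have "\<beta> (x \<otimes> y) (x \<otimes> y) = \<beta> x x * \<beta> x y * (\<beta> y x * \<beta> y y)"
        using that by (simp add: linear_character_mult[OF left] linear_character_mult[OF right])
      then have "\<beta> x y * \<beta> y x = 1" using alt that by simp
      then show ?thesis using power_n1[OF right, of x y] that by (metis inverse_unique)
    qed
    define P where "P g = (\<Otimes>i\<in>J. g i [^] c' i)" for g
    have P_closed: "P g \<in> carrier G" if "g \<in> J \<rightarrow> carrier G" for g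
      unfolding P_def using that by (intro finprod_closed) auto
    have P_char: "\<chi> (P g) = (\<Prod>i\<in>J. \<chi> (g i) ^ c' i)" if "linear_character G \<chi>" "g \<in> J \<rightarrow> carrier G" for \<chi> g
    proof -
      have "\<chi> (P g) = (\<Prod>i\<in>J. \<chi> (g i [^] c' i))"
        unfolding P_def using that J by (intro linear_character_finprod) auto
      then show ?thesis using that linear_character_pow[OF that(1)] by (auto intro!: prod.cong)
    qed
    have "(\<Sum>g\<in>I \<rightarrow>\<^sub>E carrier G. (\<Prod>i\<in>I. \<theta> (g i) ^ l i) * (\<Prod>i\<in>I. \<Prod>k\<in>I. \<beta> (g i) (g k) ^ a i k))
        = (if \<forall>x\<in>(\<lambda>h. h [^] l j) ` K1. \<theta> x = 1 then of_nat (C * card K1) else 0)"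
      if \<theta>: "linear_character G \<theta>" for \<theta>
    proof -
      let ?F = "\<lambda>g. (\<Prod>i\<in>I. \<theta> (g i) ^ l i) * (\<Prod>i\<in>I. \<Prod>k\<in>I. \<beta> (g i) (g k) ^ a i k)"
      let ?E = "\<lambda>h g. (\<Prod>i\<in>J. \<beta> h (g i) ^ l' i) * (\<Prod>i\<in>J. \<Prod>k\<in>J. \<beta> (g i) (g k) ^ a' i k)"
      have F: "?F (g(j := h \<otimes> P g)) = \<theta> h ^ l j * ?E h g"
        if h: "h \<in> carrier G" and g: "g \<in> J \<rightarrow>\<^sub>E carrier G" for h g
      proof -
        let ?x = "h \<otimes> P g"
        have gJ: "g \<in> J \<rightarrow> carrier G" and gi: "\<And>i. i \<in> J \<Longrightarrow> g i \<in> carrier G" using g by auto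
        have x: "?x \<in> carrier G" using h P_closed[OF gJ] by simp
        have upd: "i \<noteq> j" if "i \<in> J" for i using that J by auto
        have "(\<Prod>i\<in>I. \<theta> ((g(j := ?x)) i) ^ l i) = \<theta> ?x ^ l j * (\<Prod>i\<in>J. \<theta> (g i) ^ l i)"
          using J by (simp add: I upd cong: prod.cong)
        also have "\<theta> ?x = \<theta> h * (\<Prod>i\<in>J. \<theta> (g i) ^ c' i)"
          using h P_closed[OF gJ] by (simp add: linear_character_mult[OF \<theta>] P_char[OF \<theta> gJ])
        also have "(\<theta> h * (\<Prod>i\<in>J. \<theta> (g i) ^ c' i)) ^ l j * (\<Prod>i\<in>J. \<theta> (g i) ^ l i)
            = \<theta> h ^ l j * (\<Prod>i\<in>J. \<theta> (g i) ^ (c' i * l j + l i))"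
          by (simp add: power_mult_distrib power_add prod.distrib power_mult prod_power_distrib mult.assoc)
        also have "(\<Prod>i\<in>J. \<theta> (g i) ^ (c' i * l j + l i)) = 1"
          using gi c' I by (intro prod.neutral ballI power_n[OF \<theta>]) auto
        finally have 1: "(\<Prod>i\<in>I. \<theta> ((g(j := ?x)) i) ^ l i) = \<theta> h ^ l j" by simp
        have x_pow: "\<beta> ?x (g k) ^ a j k * \<beta> (g k) ?x ^ a k j
            = \<beta> h (g k) ^ l' k * (\<Prod>i\<in>J. \<beta> (g i) (g k) ^ (c' i * l' k))" if k: "k \<in> J" for k
        proof -
          have 2: "\<beta> ?x (g k) ^ a j k * \<beta> (g k) ?x ^ a k j = \<beta> ?x (g k) ^ l' k"
            using anti[OF x gi[OF k]] by (simp add: l'_def power_add power_mult)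
          have "\<beta> ?x (g k) = \<beta> h (g k) * (\<Prod>i\<in>J. \<beta> (g i) (g k) ^ c' i)"
            using h P_closed[OF gJ] gi[OF k]
            by (simp add: linear_character_mult[OF left] P_char[OF left gJ])
          then show ?thesis unfolding 2
            by (simp add: power_mult_distrib power_mult prod_power_distrib)
        qed
        have "(\<Prod>i\<in>I. \<Prod>k\<in>I. \<beta> ((g(j := ?x)) i) ((g(j := ?x)) k) ^ a i k)
            = (\<Prod>k\<in>J. \<beta> ?x (g k) ^ a j k) * (\<Prod>i\<in>J. \<beta> (g i) ?x ^ a i j * (\<Prod>k\<in>J. \<beta> (g i) (g k) ^ a i k))"
          using J x by (simp add: I upd alt cong: prod.cong)
        also have "\<dots> = (\<Prod>k\<in>J. \<beta> ?x (g k) ^ a j k * \<beta> (g k) ?x ^ a k j)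
            * (\<Prod>i\<in>J. \<Prod>k\<in>J. \<beta> (g i) (g k) ^ a i k)"
          by (simp add: prod.distrib mult.assoc)
        also have "\<dots> = (\<Prod>k\<in>J. \<beta> h (g k) ^ l' k) * (\<Prod>k\<in>J. \<Prod>i\<in>J. \<beta> (g i) (g k) ^ (c' i * l' k))
            * (\<Prod>i\<in>J. \<Prod>k\<in>J. \<beta> (g i) (g k) ^ a i k)"
          by (simp add: x_pow prod.distrib)
        also have "(\<Prod>k\<in>J. \<Prod>i\<in>J. \<beta> (g i) (g k) ^ (c' i * l' k))
            = (\<Prod>i\<in>J. \<Prod>k\<in>J. \<beta> (g i) (g k) ^ (c' i * l' k))"
          by (rule prod.swap)
        finally have 2: "(\<Prod>i\<in>I. \<Prod>k\<in>I. \<beta> ((g(j := ?x)) i) ((g(j := ?x)) k) ^ a i k)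
            = (\<Prod>k\<in>J. \<beta> h (g k) ^ l' k) * (\<Prod>i\<in>J. \<Prod>k\<in>J. \<beta> (g i) (g k) ^ (c' i * l' k))
            * (\<Prod>i\<in>J. \<Prod>k\<in>J. \<beta> (g i) (g k) ^ a i k)" .
        have 3: "(\<Prod>i\<in>J. \<Prod>k\<in>J. \<beta> (g i) (g k) ^ a' i k)
            = (\<Prod>i\<in>J. \<Prod>k\<in>J. \<beta> (g i) (g k) ^ a i k) * (\<Prod>i\<in>J. \<Prod>k\<in>J. \<beta> (g i) (g k) ^ (c' i * l' k))"
          by (simp only: a'_def power_add prod.distrib)
        show ?thesis unfolding 1 2 3 by (simp only: mult_ac)
      qed
      have restore: "(restrict g J)(j := g j \<otimes> inv (P (restrict g J)) \<otimes> P (restrict g J)) = g"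
        if g: "g \<in> I \<rightarrow>\<^sub>E carrier G" for g
      proof -
        have "restrict g J \<in> J \<rightarrow> carrier G" "g j \<in> carrier G" using g I by auto
        then have *: "g j \<otimes> inv (P (restrict g J)) \<otimes> P (restrict g J) = g j"
          using P_closed[of "restrict g J"] by (simp add: m_assoc)
        show ?thesis
        proof
          fix i
          show "((restrict g J)(j := g j \<otimes> inv (P (restrict g J)) \<otimes> P (restrict g J))) i = g i"
            using PiE_arb[OF g, of i] I unfolding * by (cases "i = j"; cases "i \<in> J") simp_all
        qed
      qed
      have restr: "restrict (g(j := y)) J = g" if g: "g \<in> J \<rightarrow>\<^sub>E carrier G" for g y
      proof
        fix i
        show "restrict (g(j := y)) J i = g i"
          using PiE_arb[OF g, of i] J(3) by (cases "i = j"; cases "i \<in> J") simp_all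
      qed
      \<comment> \<open>For a fixed tuple on \<open>J\<close> the substitution is translation of the
        variable \<open>j\<close> by \<open>P g\<close>, so it is a bijection of tuples.\<close>
      have "(\<Sum>g\<in>I \<rightarrow>\<^sub>E carrier G. ?F g) = (\<Sum>(h, g)\<in>carrier G \<times> (J \<rightarrow>\<^sub>E carrier G). ?F (g(j := h \<otimes> P g)))"
      proof (rule sum.reindex_bij_witness[of _ "\<lambda>(h, g). g(j := h \<otimes> P g)"
            "\<lambda>g. (g j \<otimes> inv (P (restrict g J)), restrict g J)"], goal_cases)
        case (1 g)
        then show ?case using restore by simp
      next
        case (2 g)
        then have "restrict g J \<in> J \<rightarrow>\<^sub>E carrier G" "restrict g J \<in> J \<rightarrow> carrier G" "g j \<in> carrier G"
          using I by auto
        then show ?case using P_closed by simp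
      next
        case (3 hg)
        then obtain h g where hg: "hg = (h, g)" "h \<in> carrier G" "g \<in> J \<rightarrow>\<^sub>E carrier G" by auto
        moreover have "P g \<in> carrier G" using hg P_closed by auto
        ultimately show ?case by (simp add: m_assoc restr)
      next
        case (4 hg)
        then obtain h g where hg: "hg = (h, g)" "h \<in> carrier G" "g \<in> J \<rightarrow>\<^sub>E carrier G" by auto
        have "P g \<in> carrier G" using hg P_closed by auto
        then have "g(j := h \<otimes> P g) \<in> insert j J \<rightarrow>\<^sub>E carrier G"
          using hg by (intro PiE_fun_upd) auto
        then show ?case by (simp add: hg(1) I)
      next
        case (5 g)
        then show ?case by (simp only: prod.case restore)
      qed
      also have "\<dots> = (\<Sum>(h, g)\<in>carrier G \<times> (J \<rightarrow>\<^sub>E carrier G). \<theta> h ^ l j * ?E h g)"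
        by (intro sum.cong refl) (clarify, rule F)
      also have "\<dots> = (\<Sum>h\<in>carrier G. \<theta> h ^ l j * (\<Sum>g\<in>J \<rightarrow>\<^sub>E carrier G. ?E h g))"
        by (simp add: sum.cartesian_product[symmetric] sum_distrib_left)
      also have "\<dots> = (\<Sum>h\<in>carrier G. \<theta> h ^ l j * (if h \<in> K1 then of_nat C else 0))"
        by (intro sum.cong refl) (simp add: CK[OF right] K1_def)
      also have "\<dots> = (\<Sum>h\<in>K1. of_nat C * \<theta> h ^ l j)"
        using fin by (intro sum.mono_neutral_cong_right) (auto simp: K1_def)
      also have "\<dots> = of_nat C * (\<Sum>h\<in>K1. \<theta> h ^ l j)"
        by (simp add: sum_distrib_left)
      also have "(\<Sum>h\<in>K1. \<theta> h ^ l j) = (if \<forall>h\<in>K1. \<theta> h ^ l j = 1 then of_nat (card K1) else 0)"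
        by (rule sum_linear_character[OF K1])
           (auto simp: K1_def linear_character_mult[OF \<theta>] power_mult_distrib)
      also have "(\<forall>h\<in>K1. \<theta> h ^ l j = 1) \<longleftrightarrow> (\<forall>x\<in>(\<lambda>h. h [^] l j) ` K1. \<theta> x = 1)"
        by (auto simp: K1_def linear_character_pow[OF \<theta>])
      finally show ?thesis by simp
    qed
    \<comment> \<open>Either \<open>J\<close> and \<open>K\<close> are empty and \<open>K1\<close>
      is the whole group, or the order already divides \<open>C\<close>.\<close>
    moreover have "card (carrier G) dvd C * card K1"
      using C by (auto simp: K1_def)
    moreover have "(\<lambda>h. h [^] l j) ` K1 \<subseteq> carrier G" by (auto simp: K1_def)
    ultimately show ?thesis by blast
  qed
qed

section \<open>Induction from a normal subgroup\<close>

lemma subspace_sum: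
  fixes F :: "'i \<Rightarrow> complex vec"
  assumes W: "VectorSpace.subspace class_ring W (module_vec TYPE(complex) d)"
    and "finite A" "\<And>a. a \<in> A \<Longrightarrow> F a \<in> W"
  shows "vec d (\<lambda>j. \<Sum>a\<in>A. F a $ j) \<in> W"
  using assms(2,3)
proof (induction A)
  case empty
  have "0\<^sub>v d \<in> W"
    using W by (auto simp: VectorSpace.subspace_def LinearCombinations.submodule_def module_vec_simps)
  moreover have "0\<^sub>v d = vec d (\<lambda>j. \<Sum>a\<in>{}. F a $ j)" by (simp add: zero_vec_def)
  ultimately show ?case by simp
next
  case (insert x A)
  have "F x + vec d (\<lambda>j. \<Sum>a\<in>A. F a $ j) \<in> W"
    using W insert by (auto simp: VectorSpace.subspace_def LinearCombinations.submodule_def module_vec_simps)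
  moreover have "F x \<in> carrier_vec d"
    using W insert by (auto simp: VectorSpace.subspace_def LinearCombinations.submodule_def module_vec_simps)
  then have "F x + vec d (\<lambda>j. \<Sum>a\<in>A. F a $ j) = vec d (\<lambda>j. \<Sum>a\<in>insert x A. F a $ j)"
    using insert by (intro eq_vecI) auto
  ultimately show ?case by simp
qed

lemma subspace_smult:
  assumes "VectorSpace.subspace class_ring W (module_vec TYPE(complex) d)" "v \<in> W"
  shows "c \<cdot>\<^sub>v v \<in> W"
  using assms by (auto simp: VectorSpace.subspace_def LinearCombinations.submodule_def module_vec_simps)

lemma subspace_carrier:
  assumes "VectorSpace.subspace class_ring W (module_vec TYPE(complex) d)"
  shows "W \<subseteq> carrier_vec d"
  using assms by (auto simp: VectorSpace.subspace_def LinearCombinations.submodule_def module_vec_simps)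

text \<open>The property that defines \<open>r x\<close> depends only on the left coset of
  \<open>x\<close>, so the choice yields one representative per coset. Numbering them provides the
  matrix indices of the induced representation.\<close>

lemma (in group) ex_transversal:
  assumes fin: "finite (carrier G)" and M: "subgroup M G"
  obtains d :: nat and t where "\<And>i. i < d \<Longrightarrow> t i \<in> carrier G"
    and "\<And>x. x \<in> carrier G \<Longrightarrow> \<exists>!i. i < d \<and> inv (t i) \<otimes> x \<in> M"
proof -
  interpret M: subgroup M G by (rule M)
  define r where "r x = (SOME y. y \<in> carrier G \<and> inv y \<otimes> x \<in> M)" for x
  have r: "r x \<in> carrier G" "inv (r x) \<otimes> x \<in> M" if "x \<in> carrier G" for x
    using someI[of "\<lambda>y. y \<in> carrier G \<and> inv y \<otimes> x \<in> M" x] that by (auto simp: r_def)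
  have r_eq: "r x = r y" if x: "x \<in> carrier G" and y: "y \<in> carrier G" and xy: "inv x \<otimes> y \<in> M" for x y
  proof -
    have "inv z \<otimes> x \<in> M \<longleftrightarrow> inv z \<otimes> y \<in> M" if z: "z \<in> carrier G" for z
    proof -
      have *: "inv z \<otimes> y = (inv z \<otimes> x) \<otimes> (inv x \<otimes> y)"
        using z x y by (simp add: m_assoc) (simp flip: m_assoc)
      have **: "inv z \<otimes> x = (inv z \<otimes> y) \<otimes> inv (inv x \<otimes> y)"
        using z x y by (simp add: inv_mult_group m_assoc) (simp flip: m_assoc)
      show ?thesis
        using M.m_closed[OF _ xy] M.m_closed[OF _ M.m_inv_closed[OF xy]] by (metis * **)
    qed
    then show ?thesis unfolding r_def by (metis (no_types, lifting))
  qed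
  have "finite (r ` carrier G)" using fin by simp
  then obtain t where t: "bij_betw t {..<card (r ` carrier G)} (r ` carrier G)"
    using ex_bij_betw_nat_finite[of "r ` carrier G"] by (auto simp: atLeast0LessThan)
  have uniq: "\<exists>!i. i < card (r ` carrier G) \<and> inv (t i) \<otimes> x \<in> M" if x: "x \<in> carrier G" for x
  proof -
    have "r x \<in> t ` {..<card (r ` carrier G)}" using t x by (simp add: bij_betw_def)
    then obtain i where i: "i < card (r ` carrier G)" "t i = r x" by (metis imageE lessThan_iff)
    show ?thesis
    proof (rule ex1I[of _ i])
      show "i < card (r ` carrier G) \<and> inv (t i) \<otimes> x \<in> M" using i r x by simp
    next
      fix k assume k: "k < card (r ` carrier G) \<and> inv (t k) \<otimes> x \<in> M"
      obtain y where y: "y \<in> carrier G" "t k = r y"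
        using bij_betw_apply[OF t, of k] k by auto
      have "r (t k) = r x" using r_eq[of "t k" x] k x y r by auto
      moreover have "r (t k) = r y" using r_eq[of "t k" y] y r by auto
      ultimately have "t k = t i" using y i by simp
      then show "k = i" using inj_onD[OF bij_betw_imp_inj_on[OF t], of k i] k i by auto
    qed
  qed
  have "t i \<in> carrier G" if "i < card (r ` carrier G)" for i
    using bij_betw_apply[OF t, of i] that r by auto
  with uniq show ?thesis using that by blast
qed

text \<open>Mackey's criterion for a linear character \<open>\<nu>\<close> of a normal subgroup \<open>M\<close>: the restriction to
  \<open>M\<close> of the induced representation is diagonal with distinct characters.\<close>

lemma (in group) induced_irreducible:
  fixes \<nu> :: "'a \<Rightarrow> complex"
  assumes fin: "finite (carrier G)" and M: "subgroup M G"
    and normal: "\<And>x m. x \<in> carrier G \<Longrightarrow> m \<in> M \<Longrightarrow> inv x \<otimes> m \<otimes> x \<in> M"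
    and one: "\<nu> \<one> = 1"
    and mult: "\<And>x y. x \<in> M \<Longrightarrow> y \<in> M \<Longrightarrow> \<nu> (x \<otimes> y) = \<nu> x * \<nu> y"
    and stable: "\<And>x. x \<in> carrier G \<Longrightarrow> (\<And>m. m \<in> M \<Longrightarrow> \<nu> (inv x \<otimes> m \<otimes> x) = \<nu> m) \<Longrightarrow> x \<in> M"
  shows "(\<lambda>g\<in>carrier G. (\<Sum>x\<in>carrier G. if inv x \<otimes> g \<otimes> x \<in> M then \<nu> (inv x \<otimes> g \<otimes> x) else 0)
           / of_nat (card M)) \<in> irr_characters G"
proof -
  interpret M: subgroup M G by (rule M)
  \<comment> \<open>With \<open>\<nu>\<close> extended by zero, the entry (i, j) of the induced
    matrix of \<open>g\<close> is \<open>\<mu> (inv (t i) \<otimes> g \<otimes> t j)\<close>,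
    nonzero only if \<open>g\<close> sends the coset of \<open>t j\<close> to that of
    \<open>t i\<close>.\<close>
  define \<mu> where "\<mu> y = (if y \<in> M then \<nu> y else 0)" for y
  have cancel: "x \<otimes> (inv x \<otimes> y) = y" "inv x \<otimes> (x \<otimes> y) = y"
    if "x \<in> carrier G" "y \<in> carrier G" for x y
    using that by (simp_all flip: m_assoc)
  have \<mu>_mult: "\<mu> (x \<otimes> y) = \<mu> x * \<nu> y" if "x \<in> carrier G" "y \<in> M" for x y
  proof -
    have "x \<in> M" if "x \<otimes> y \<in> M"
    proof -
      have "(x \<otimes> y) \<otimes> inv y \<in> M" using M.m_closed[OF that M.m_inv_closed[OF \<open>y \<in> M\<close>]] .
      then show ?thesis using \<open>x \<in> carrier G\<close> \<open>y \<in> M\<close> by (simp add: m_assoc)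
    qed
    then show ?thesis using that by (auto simp: \<mu>_def mult)
  qed
  have inv\<nu>: "\<nu> (inv m) * \<nu> m = 1" if "m \<in> M" for m
    using mult[of "inv m" m] that one by simp
  have \<mu>_conj: "\<mu> (inv m \<otimes> y \<otimes> m) = \<mu> y" if "y \<in> carrier G" "m \<in> M" for y m
  proof (cases "y \<in> M")
    case True
    then show ?thesis using that inv\<nu>[of m] by (simp add: \<mu>_def mult mult_ac)
  next
    case False
    have "inv m \<otimes> y \<otimes> m \<notin> M"
    proof
      assume "inv m \<otimes> y \<otimes> m \<in> M"
      then have "m \<otimes> (inv m \<otimes> y \<otimes> m) \<otimes> inv m \<in> M"
        using M.m_closed[OF M.m_closed[OF that(2)] M.m_inv_closed[OF that(2)]] by simp
      then show False using False that by (simp add: m_assoc cancel)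
    qed
    then show ?thesis using False by (simp add: \<mu>_def)
  qed
  obtain d t where t: "\<And>i. i < d \<Longrightarrow> t i \<in> carrier G"
    and uniq: "\<And>x. x \<in> carrier G \<Longrightarrow> \<exists>!i. i < (d::nat) \<and> inv (t i) \<otimes> x \<in> M"
    using ex_transversal[OF fin M] by blast
  have d0: "d > 0" using uniq[of \<one>] by auto
  have coset: "inv (t i) \<otimes> t j \<in> M \<longleftrightarrow> i = j" if "i < d" "j < d" for i j
    using uniq[OF t[OF that(2)]] that t by (metis l_inv M.one_closed)
  define \<rho> where "\<rho> g = mat d d (\<lambda>(i, j). \<mu> (inv (t i) \<otimes> g \<otimes> t j))" for g
  have \<rho>_carrier: "\<rho> g \<in> carrier_mat d d" for g by (simp add: \<rho>_def)
  have \<rho>_mult: "\<rho> (g \<otimes> h) = \<rho> g * \<rho> h" if gh: "g \<in> carrier G" "h \<in> carrier G" for g h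
  proof (rule eq_matI)
    fix i k assume "i < dim_row (\<rho> g * \<rho> h)" "k < dim_col (\<rho> g * \<rho> h)"
    then have ik: "i < d" "k < d" by (auto simp: \<rho>_def)
    have "h \<otimes> t k \<in> carrier G" using gh t[OF ik(2)] by simp
    then obtain j where j: "j < d" "inv (t j) \<otimes> (h \<otimes> t k) \<in> M"
      and j': "\<And>i. i < d \<Longrightarrow> inv (t i) \<otimes> (h \<otimes> t k) \<in> M \<Longrightarrow> i = j"
      using uniq unfolding Ex1_def by blast
    have "(\<rho> g * \<rho> h) $$ (i, k)
        = (\<Sum>j<d. \<mu> (inv (t i) \<otimes> g \<otimes> t j) * \<mu> (inv (t j) \<otimes> h \<otimes> t k))"
      using ik by (simp add: \<rho>_def scalar_prod_def atLeast0LessThan)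
    \<comment> \<open>Only the coset that contains \<open>h \<otimes> t k\<close> contributes to the
      matrix product.\<close>
    also have "\<dots> = (\<Sum>l<d. if l = j then \<mu> (inv (t i) \<otimes> g \<otimes> t j) * \<mu> (inv (t j) \<otimes> h \<otimes> t k) else 0)"
    proof (intro sum.cong refl)
      fix l assume "l \<in> {..<d}"
      then have "inv (t l) \<otimes> h \<otimes> t k = inv (t l) \<otimes> (h \<otimes> t k)" "l \<noteq> j \<longrightarrow> inv (t l) \<otimes> (h \<otimes> t k) \<notin> M"
        using j' gh t[of l] t[OF ik(2)] by (auto simp: m_assoc)
      then show "\<mu> (inv (t i) \<otimes> g \<otimes> t l) * \<mu> (inv (t l) \<otimes> h \<otimes> t k)
          = (if l = j then \<mu> (inv (t i) \<otimes> g \<otimes> t j) * \<mu> (inv (t j) \<otimes> h \<otimes> t k) else 0)"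
        by (cases "l = j") (simp_all add: \<mu>_def)
    qed
    also have "\<dots> = \<mu> (inv (t i) \<otimes> g \<otimes> t j) * \<nu> (inv (t j) \<otimes> (h \<otimes> t k))"
      using j gh t ik by (simp add: \<mu>_def m_assoc)
    also have "\<dots> = \<mu> (inv (t i) \<otimes> g \<otimes> t j \<otimes> (inv (t j) \<otimes> (h \<otimes> t k)))"
      using j gh t ik by (intro \<mu>_mult[symmetric]) auto
    also have "inv (t i) \<otimes> g \<otimes> t j \<otimes> (inv (t j) \<otimes> (h \<otimes> t k)) = inv (t i) \<otimes> (g \<otimes> h) \<otimes> t k"
      using j gh t ik by (simp add: m_assoc cancel)
    finally show "\<rho> (g \<otimes> h) $$ (i, k) = (\<rho> g * \<rho> h) $$ (i, k)"
      using ik by (simp add: \<rho>_def)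
  qed (auto simp: \<rho>_def)
  have \<rho>_one: "\<rho> \<one> = 1\<^sub>m d"
    using t by (intro eq_matI) (auto simp: \<rho>_def \<mu>_def coset one)
  have rep: "representation G d \<rho>"
    unfolding representation_def
  proof (rule homI)
    fix g assume g: "g \<in> carrier G"
    have "\<rho> (inv g) * \<rho> g = 1\<^sub>m d" "\<rho> g * \<rho> (inv g) = 1\<^sub>m d"
      using g by (simp_all flip: \<rho>_mult add: \<rho>_one)
    then show "\<rho> g \<in> carrier (units_of (ring_mat TYPE(complex) d ()))"
      using \<rho>_carrier by (auto simp: units_of_def Units_def ring_mat_simps)
  qed (simp add: \<rho>_mult units_of_def ring_mat_simps)
  \<comment> \<open>By normality the elements of \<open>M\<close> leave each coset in place, so they
    act diagonally; the j-th entry is the conjugate of \<open>\<nu>\<close> by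
    \<open>t j\<close>.\<close>
  have diag: "(\<rho> m *\<^sub>v v) $ j = \<nu> (inv (t j) \<otimes> m \<otimes> t j) * v $ j"
    if m: "m \<in> M" and v: "v \<in> carrier_vec d" and j: "j < d" for m v j
  proof -
    have "\<mu> (inv (t j) \<otimes> m \<otimes> t k) = (if k = j then \<nu> (inv (t j) \<otimes> m \<otimes> t j) else 0)"
      if k: "k < d" for k
    proof -
      have cM: "inv (t j) \<otimes> m \<otimes> t j \<in> M" using normal m j t by simp
      have "inv (t j) \<otimes> t k \<in> M" if "inv (t j) \<otimes> m \<otimes> t k \<in> M"
      proof -
        have "inv (inv (t j) \<otimes> m \<otimes> t j) \<otimes> (inv (t j) \<otimes> m \<otimes> t k) \<in> M"
          using M.m_closed[OF M.m_inv_closed[OF cM] that] .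
        then show ?thesis using j k m t by (simp add: inv_mult_group m_assoc cancel)
      qed
      then show ?thesis using cM coset[OF j k] by (auto simp: \<mu>_def)
    qed
    then have "(\<Sum>k<d. \<mu> (inv (t j) \<otimes> m \<otimes> t k) * v $ k)
        = (\<Sum>k<d. if k = j then \<nu> (inv (t j) \<otimes> m \<otimes> t j) * v $ k else 0)"
      by (intro sum.cong refl) simp
    moreover have "(\<rho> m *\<^sub>v v) $ j = (\<Sum>k<d. \<mu> (inv (t j) \<otimes> m \<otimes> t k) * v $ k)"
      using j v by (simp add: \<rho>_def scalar_prod_def atLeast0LessThan)
    ultimately show ?thesis using j by simp
  qed
  have irr: "W = {0\<^sub>v d} \<or> W = carrier_vec d"
    if W: "VectorSpace.subspace class_ring W (module_vec TYPE(complex) d)"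
      and inv: "\<And>g v. g \<in> carrier G \<Longrightarrow> v \<in> W \<Longrightarrow> \<rho> g *\<^sub>v v \<in> W" for W
  proof (cases "W \<subseteq> {0\<^sub>v d}")
    case True
    have "0\<^sub>v d \<in> W" using W by (auto simp: VectorSpace.subspace_def LinearCombinations.submodule_def module_vec_simps)
    then show ?thesis using True by auto
  next
    case False
    then obtain v where v: "v \<in> W" "v \<noteq> 0\<^sub>v d" by auto
    have vd: "v \<in> carrier_vec d" using subspace_carrier[OF W] v by auto
    then obtain i where i: "i < d" "v $ i \<noteq> 0"
      using v(2) by (metis carrier_vecD eq_vecI index_zero_vec(1,2))
    have \<nu>0: "\<nu> m \<noteq> 0" if "m \<in> M" for m using inv\<nu>[OF that] by auto
    \<comment> \<open>Summing over \<open>M\<close> against the inverse of the i-th conjugate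
      character isolates the i-th coordinate of \<open>v\<close>, because the conjugate characters
      are pairwise distinct.\<close>
    define F where "F m = inverse (\<nu> (inv (t i) \<otimes> m \<otimes> t i)) \<cdot>\<^sub>v (\<rho> m *\<^sub>v v)" for m
    define u where "u = vec d (\<lambda>j. \<Sum>m\<in>M. F m $ j)"
    have finM: "finite M" using fin by (rule finite_subset[rotated]) auto
    have dim_u: "dim_vec u = d" by (simp add: u_def)
    have "u \<in> W"
      unfolding u_def F_def using W v finM by (intro subspace_sum subspace_smult inv) auto
    have u: "u $ j = (if j = i then of_nat (card M) * v $ i else 0)" if j: "j < d" for j
    proof -
      define \<chi> where "\<chi> m = \<nu> (inv (t j) \<otimes> m \<otimes> t j) * inverse (\<nu> (inv (t i) \<otimes> m \<otimes> t i))" for m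
      have conj_mult: "\<nu> (inv (t k) \<otimes> (m \<otimes> m') \<otimes> t k)
          = \<nu> (inv (t k) \<otimes> m \<otimes> t k) * \<nu> (inv (t k) \<otimes> m' \<otimes> t k)"
        if "m \<in> M" "m' \<in> M" "k < d" for m m' k
      proof -
        have "inv (t k) \<otimes> (m \<otimes> m') \<otimes> t k = (inv (t k) \<otimes> m \<otimes> t k) \<otimes> (inv (t k) \<otimes> m' \<otimes> t k)"
          using that t by (simp add: m_assoc cancel)
        then show ?thesis using that t normal by (simp add: mult)
      qed
      have "(\<forall>m\<in>M. \<chi> m = 1) \<longleftrightarrow> j = i"
      proof
        assume *: "\<forall>m\<in>M. \<chi> m = 1"
        \<comment> \<open>Equality of the conjugates of \<open>\<nu>\<close> by \<open>t i\<close>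
          and \<open>t j\<close> means that \<open>inv (t i) \<otimes> t j\<close> stabilizes
          \<open>\<nu>\<close>.\<close>
        have "inv (t i) \<otimes> t j \<in> M"
        proof (rule stable)
          fix m assume m: "m \<in> M"
          have m': "t i \<otimes> m \<otimes> inv (t i) \<in> M" using normal[of "inv (t i)" m] m t i by simp
          have "inv (t i) \<otimes> (t i \<otimes> m \<otimes> inv (t i)) \<otimes> t i = m"
            using m t i by (simp add: m_assoc cancel)
          moreover have "inv (t j) \<otimes> (t i \<otimes> m \<otimes> inv (t i)) \<otimes> t j
              = inv (inv (t i) \<otimes> t j) \<otimes> m \<otimes> (inv (t i) \<otimes> t j)"
            using m t i j by (simp add: m_assoc inv_mult_group)
          ultimately show "\<nu> (inv (inv (t i) \<otimes> t j) \<otimes> m \<otimes> (inv (t i) \<otimes> t j)) = \<nu> m"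
            using bspec[OF * m'] \<nu>0[OF m] by (simp add: \<chi>_def field_simps)
        qed (use t i j in auto)
        then show "j = i" using coset i j by auto
      next
        assume "j = i"
        then show "\<forall>m\<in>M. \<chi> m = 1"
          using normal t i \<nu>0 by (auto simp: \<chi>_def)
      qed
      moreover have "(\<Sum>m\<in>M. \<chi> m) = (if \<forall>m\<in>M. \<chi> m = 1 then of_nat (card M) else 0)"
        by (rule sum_linear_character[OF M]) (use i j in \<open>simp add: \<chi>_def conj_mult mult_ac\<close>)
      moreover have "F m $ j = \<chi> m * v $ j" if m: "m \<in> M" for m
      proof -
        have "F m $ j = inverse (\<nu> (inv (t i) \<otimes> m \<otimes> t i)) * (\<rho> m *\<^sub>v v) $ j"
          unfolding F_def using j by (intro index_smult_vec(1)) (simp add: \<rho>_def)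
        then show ?thesis unfolding diag[OF m vd j] \<chi>_def by (simp only: mult_ac)
      qed
      then have "u $ j = (\<Sum>m\<in>M. \<chi> m * v $ j)"
        using j by (simp add: u_def)
      ultimately show ?thesis by (simp flip: sum_distrib_right)
    qed
    have cM: "card M > 0" using finM M.one_closed by (metis card_gt_0_iff empty_iff)
    have "inverse (of_nat (card M) * v $ i) \<cdot>\<^sub>v u = unit_vec d i"
      using i cM dim_u by (intro eq_vecI) (auto simp: u field_simps)
    then have ei: "unit_vec d i \<in> W" using subspace_smult[OF W \<open>u \<in> W\<close>] by metis
    \<comment> \<open>The group permutes the coordinate lines transitively, so one unit vector in
      \<open>W\<close> yields all of them.\<close>
    have ej: "unit_vec d j \<in> W" if j: "j < d" for j
    proof -
      have "\<rho> (t j \<otimes> inv (t i)) *\<^sub>v unit_vec d i = unit_vec d j"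
      proof (rule eq_vecI)
        fix k assume "k < dim_vec (unit_vec d j :: complex vec)"
        then have k: "k < d" by simp
        have "(\<rho> (t j \<otimes> inv (t i)) *\<^sub>v unit_vec d i) $ k = \<mu> (inv (t k) \<otimes> (t j \<otimes> inv (t i)) \<otimes> t i)"
          using i k by (simp add: \<rho>_def)
        also have "inv (t k) \<otimes> (t j \<otimes> inv (t i)) \<otimes> t i = inv (t k) \<otimes> t j"
          using i j k t by (simp add: m_assoc)
        finally show "(\<rho> (t j \<otimes> inv (t i)) *\<^sub>v unit_vec d i) $ k = unit_vec d j $ k"
          using j k t by (auto simp: \<mu>_def coset one)
      qed (simp add: \<rho>_def)
      then show ?thesis using inv[OF _ ei, of "t j \<otimes> inv (t i)"] i j t by auto
    qed
    have "w \<in> W" if w: "w \<in> carrier_vec d" for w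
    proof -
      have "vec d (\<lambda>j. \<Sum>k<d. (w $ k \<cdot>\<^sub>v unit_vec d k) $ j) \<in> W"
        using ej by (intro subspace_sum[OF W] subspace_smult[OF W]) auto
      also have "vec d (\<lambda>j. \<Sum>k<d. (w $ k \<cdot>\<^sub>v unit_vec d k) $ j) = w"
      proof (rule eq_vecI)
        fix j assume "j < dim_vec w"
        then have j: "j < d" using w by auto
        have "(\<Sum>k<d. (w $ k \<cdot>\<^sub>v unit_vec d k) $ j) = (\<Sum>k<d. if k = j then w $ k else 0)"
          using j by (intro sum.cong refl) auto
        then show "vec d (\<lambda>j. \<Sum>k<d. (w $ k \<cdot>\<^sub>v unit_vec d k) $ j) $ j = w $ j" using j by simp
      qed (use w in auto)
      finally show ?thesis .
    qed
    then show ?thesis using subspace_carrier[OF W] by auto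
  qed
  have "mat_trace (\<rho> g) = (\<Sum>x\<in>carrier G. \<mu> (inv x \<otimes> g \<otimes> x)) / of_nat (card M)"
    if g: "g \<in> carrier G" for g
  proof -
    define ix where "ix x = (THE i. i < d \<and> inv (t i) \<otimes> x \<in> M)" for x
    have ix: "ix x < d \<and> inv (t (ix x)) \<otimes> x \<in> M" if "x \<in> carrier G" for x
      unfolding ix_def using theI'[OF uniq[OF that]] .
    have ix_eq: "ix (t i \<otimes> m) = i" if "i < d" "m \<in> M" for i m
    proof -
      have x: "t i \<otimes> m \<in> carrier G" using that t by simp
      have "inv (t i) \<otimes> (t i \<otimes> m) \<in> M" using that t by (simp add: cancel)
      then show ?thesis using uniq[OF x] ix[OF x] that by blast
    qed
    \<comment> \<open>Every \<open>x\<close> is \<open>t i \<otimes> m\<close> for a unique pair,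
      and the summand does not depend on \<open>m\<close>; the sum is therefore the order of
      \<open>M\<close> times the trace.\<close>
    have "(\<Sum>x\<in>carrier G. \<mu> (inv x \<otimes> g \<otimes> x))
        = (\<Sum>(i, m)\<in>{..<d} \<times> M. \<mu> (inv (t i \<otimes> m) \<otimes> g \<otimes> (t i \<otimes> m)))"
      by (rule sum.reindex_bij_witness[of _ "\<lambda>(i, m). t i \<otimes> m" "\<lambda>x. (ix x, inv (t (ix x)) \<otimes> x)"])
        (use ix t in \<open>auto simp: cancel ix_eq\<close>)
    also have "\<dots> = (\<Sum>(i, m)\<in>{..<d} \<times> M. \<mu> (inv (t i) \<otimes> g \<otimes> t i))"
    proof (rule sum.cong[OF refl])
      fix z assume "z \<in> {..<d} \<times> M"
      then obtain i m where z: "z = (i, m)" "i < d" "m \<in> M" by auto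
      then have "\<mu> (inv m \<otimes> (inv (t i) \<otimes> g \<otimes> t i) \<otimes> m) = \<mu> (inv (t i) \<otimes> g \<otimes> t i)"
        using t g by (intro \<mu>_conj) auto
      moreover have "inv m \<otimes> (inv (t i) \<otimes> g \<otimes> t i) \<otimes> m = inv (t i \<otimes> m) \<otimes> g \<otimes> (t i \<otimes> m)"
        using z t g by (simp add: inv_mult_group m_assoc)
      ultimately show "(case z of (i, m) \<Rightarrow> \<mu> (inv (t i \<otimes> m) \<otimes> g \<otimes> (t i \<otimes> m)))
          = (case z of (i, m) \<Rightarrow> \<mu> (inv (t i) \<otimes> g \<otimes> t i))"
        using z by simp
    qed
    also have "\<dots> = of_nat (card M) * (\<Sum>i<d. \<mu> (inv (t i) \<otimes> g \<otimes> t i))"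
      by (simp add: sum.cartesian_product[symmetric] sum_distrib_left)
    also have "(\<Sum>i<d. \<mu> (inv (t i) \<otimes> g \<otimes> t i)) = mat_trace (\<rho> g)"
      by (simp add: mat_trace_def \<rho>_def)
    finally have "(\<Sum>x\<in>carrier G. \<mu> (inv x \<otimes> g \<otimes> x)) = of_nat (card M) * mat_trace (\<rho> g)" .
    moreover have "card M > 0"
      using fin M.subset M.one_closed by (metis card_gt_0_iff empty_iff finite_subset)
    ultimately show ?thesis by simp
  qed
  then have "(\<lambda>g\<in>carrier G. (\<Sum>x\<in>carrier G. \<mu> (inv x \<otimes> g \<otimes> x)) / of_nat (card M))
      = (\<lambda>g\<in>carrier G. mat_trace (\<rho> g))"
    by (intro restrict_ext) simp
  moreover have "irreducible_representation G d \<rho>"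
    unfolding irreducible_representation_def using rep d0 irr by blast
  ultimately show ?thesis unfolding irr_characters_def \<mu>_def by blast
qed

section \<open>The Baer correspondence in class two\<close>

text \<open>Centrality of commutators encodes class at most two, and odd order provides the square
  roots used in the Baer product.\<close>

locale odd_class_two_group = group +
  assumes fin: "finite (carrier G)"
    and odd_card: "odd (card (carrier G))"
    and commutator_central:
      "\<lbrakk>x \<in> carrier G; y \<in> carrier G; z \<in> carrier G\<rbrakk> \<Longrightarrow>
         (x \<otimes> y \<otimes> inv x \<otimes> inv y) \<otimes> z = z \<otimes> (x \<otimes> y \<otimes> inv x \<otimes> inv y)"
begin

definition commutator :: "'a \<Rightarrow> 'a \<Rightarrow> 'a" where
  "commutator x y = x \<otimes> y \<otimes> inv x \<otimes> inv y"

text \<open>This represents the inverse of 2 modulo the group order.\<close>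

abbreviation half_exponent :: nat where
  "half_exponent \<equiv> (card (carrier G) + 1) div 2"

text \<open>As the order is odd, this is the square root of \<open>[y, x]\<close>.\<close>

definition half_commutator :: "'a \<Rightarrow> 'a \<Rightarrow> 'a" where
  "half_commutator x y = commutator y x [^] half_exponent"

text \<open>The additive group of the Lie ring that the Baer correspondence attaches to \<open>G\<close>.\<close>

definition baer :: "'a monoid" where
  "baer = \<lparr>carrier = carrier G, monoid.mult = (\<lambda>x y. x \<otimes> y \<otimes> half_commutator x y), one = \<one>\<rparr>"

lemma baer_simps [simp]:
  "carrier baer = carrier G"
  "\<one>\<^bsub>baer\<^esub> = \<one>"
  "x \<otimes>\<^bsub>baer\<^esub> y = x \<otimes> y \<otimes> half_commutator x y"
  by (simp_all add: baer_def)

section \<open>Commutator calculus in class two\<close>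

lemma cancel:
  assumes "x \<in> carrier G" "y \<in> carrier G"
  shows "x \<otimes> (inv x \<otimes> y) = y" "inv x \<otimes> (x \<otimes> y) = y"
  using assms by (simp_all flip: m_assoc)

lemma commutator_closed [simp]:
  "x \<in> carrier G \<Longrightarrow> y \<in> carrier G \<Longrightarrow> commutator x y \<in> carrier G"
  by (simp add: commutator_def)

lemma commutator_commutes:
  "x \<in> carrier G \<Longrightarrow> y \<in> carrier G \<Longrightarrow> z \<in> carrier G \<Longrightarrow>
     commutator x y \<otimes> z = z \<otimes> commutator x y"
  by (simp add: commutator_def commutator_central)

lemma commutator_swap:
  assumes "x \<in> carrier G" "y \<in> carrier G"
  shows "x \<otimes> y = commutator x y \<otimes> (y \<otimes> x)"
  using assms by (simp add: commutator_def m_assoc cancel)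

text \<open>Cancellation makes the factor that turns \<open>y \<otimes> x\<close> into
  \<open>x \<otimes> y\<close> unique, so commutators can be computed by rearranging
  products.\<close>

lemma commutator_eqI:
  assumes "x \<in> carrier G" "y \<in> carrier G" "c \<in> carrier G" "x \<otimes> y = c \<otimes> (y \<otimes> x)"
  shows "commutator x y = c"
  using commutator_swap[of x y] right_cancel[of "y \<otimes> x" "commutator x y" c] assms by simp

text \<open>Moving \<open>z\<close> to the front past \<open>y\<close> and then past
  \<open>x\<close> creates one commutator each time, and both can be collected because they are
  central.\<close>

lemma commutator_mult_left:
  assumes "x \<in> carrier G" "y \<in> carrier G" "z \<in> carrier G"
  shows "commutator (x \<otimes> y) z = commutator x z \<otimes> commutator y z"
proof (rule commutator_eqI)
  have "(x \<otimes> y) \<otimes> z = x \<otimes> (commutator y z \<otimes> (z \<otimes> y))"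
    using assms commutator_swap[of y z] by (simp add: m_assoc)
  also have "\<dots> = commutator y z \<otimes> (x \<otimes> z) \<otimes> y"
    using assms commutator_commutes[of y z x] by (simp flip: m_assoc)
  also have "x \<otimes> z = commutator x z \<otimes> (z \<otimes> x)"
    using assms by (intro commutator_swap)
  also have "commutator y z \<otimes> (commutator x z \<otimes> (z \<otimes> x)) \<otimes> y
      = commutator x z \<otimes> commutator y z \<otimes> (z \<otimes> (x \<otimes> y))"
    using assms commutator_commutes[of y z "commutator x z"] by (simp add: m_assoc flip: m_assoc)
  finally show "(x \<otimes> y) \<otimes> z = commutator x z \<otimes> commutator y z \<otimes> (z \<otimes> (x \<otimes> y))" .
qed (use assms in auto)

lemma commutator_inverse:
  assumes "x \<in> carrier G" "y \<in> carrier G"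
  shows "inv (commutator x y) = commutator y x"
  using assms by (simp add: commutator_def inv_mult_group m_assoc)

lemma commutator_mult_right:
  assumes "x \<in> carrier G" "y \<in> carrier G" "z \<in> carrier G"
  shows "commutator x (y \<otimes> z) = commutator x y \<otimes> commutator x z"
proof -
  have "commutator x (y \<otimes> z) = inv (commutator (y \<otimes> z) x)"
    using assms by (simp add: commutator_inverse)
  also have "\<dots> = commutator x z \<otimes> commutator x y"
    using assms by (simp add: commutator_mult_left inv_mult_group commutator_inverse)
  also have "\<dots> = commutator x y \<otimes> commutator x z"
    using assms by (intro commutator_commutes) auto
  finally show ?thesis .
qed

lemma commutator_self: "x \<in> carrier G \<Longrightarrow> commutator x x = \<one>"
  by (intro commutator_eqI) auto

definition central :: "'a \<Rightarrow> bool" where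
  "central c \<longleftrightarrow> c \<in> carrier G \<and> (\<forall>z\<in>carrier G. c \<otimes> z = z \<otimes> c)"

lemma central_commutator: "x \<in> carrier G \<Longrightarrow> y \<in> carrier G \<Longrightarrow> central (commutator x y)"
  by (simp add: central_def commutator_commutes)

lemma central_pow: "central c \<Longrightarrow> central (c [^] (n::nat))"
  by (simp add: central_def group_commutes_pow)

lemma commutator_central_left:
  "central c \<Longrightarrow> x \<in> carrier G \<Longrightarrow> commutator c x = \<one>"
  by (intro commutator_eqI) (auto simp: central_def)

lemma commutator_central_right:
  "central c \<Longrightarrow> x \<in> carrier G \<Longrightarrow> commutator x c = \<one>"
  by (intro commutator_eqI) (auto simp: central_def)

lemma central_half_commutator:
  "x \<in> carrier G \<Longrightarrow> y \<in> carrier G \<Longrightarrow> central (half_commutator x y)"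
  by (simp add: half_commutator_def central_pow central_commutator)

lemma half_commutator_closed [simp]:
  "x \<in> carrier G \<Longrightarrow> y \<in> carrier G \<Longrightarrow> half_commutator x y \<in> carrier G"
  using central_half_commutator by (simp add: central_def)

lemma half_commutator_commutes:
  "x \<in> carrier G \<Longrightarrow> y \<in> carrier G \<Longrightarrow> z \<in> carrier G \<Longrightarrow>
     half_commutator x y \<otimes> z = z \<otimes> half_commutator x y"
  using central_half_commutator[of x y] by (simp add: central_def)

lemma half_commutator_double:
  assumes "x \<in> carrier G" "y \<in> carrier G"
  shows "half_commutator x y \<otimes> half_commutator x y = commutator y x"
proof -
  have "half_exponent + half_exponent = card (carrier G) + 1"
    using odd_card by (auto elim!: oddE)
  then have "half_commutator x y \<otimes> half_commutator x y = commutator y x [^] (card (carrier G) + 1)"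
    using assms by (simp add: half_commutator_def nat_pow_mult)
  also have "\<dots> = commutator y x"
    using assms pow_order_eq_1[of "commutator y x"] by (simp add: Coset.order_def)
  finally show ?thesis .
qed

text \<open>Commutators are bilinear, and taking powers is multiplicative on commuting
  elements.\<close>

lemma half_commutator_mult_left:
  assumes "x \<in> carrier G" "y \<in> carrier G" "z \<in> carrier G"
  shows "half_commutator (x \<otimes> y) z = half_commutator x z \<otimes> half_commutator y z"
  using assms
  by (simp add: half_commutator_def commutator_mult_right pow_mult_distrib[OF commutator_commutes])

lemma half_commutator_mult_right:
  assumes "x \<in> carrier G" "y \<in> carrier G" "z \<in> carrier G"
  shows "half_commutator x (y \<otimes> z) = half_commutator x y \<otimes> half_commutator x z"
  using assms
  by (simp add: half_commutator_def commutator_mult_left pow_mult_distrib[OF commutator_commutes])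

lemma half_commutator_central_left:
  "central c \<Longrightarrow> x \<in> carrier G \<Longrightarrow> half_commutator c x = \<one>"
  by (simp add: half_commutator_def commutator_central_right)

lemma half_commutator_central_right:
  "central c \<Longrightarrow> x \<in> carrier G \<Longrightarrow> half_commutator x c = \<one>"
  by (simp add: half_commutator_def commutator_central_left)

lemma central_one: "central \<one>"
  by (simp add: central_def)

lemma half_commutator_swap:
  assumes "x \<in> carrier G" "y \<in> carrier G"
  shows "half_commutator x y \<otimes> half_commutator y x = \<one>"
proof -
  have "half_commutator y x = inv (half_commutator x y)"
    using assms by (simp add: half_commutator_def commutator_inverse flip: nat_pow_inv)
  then show ?thesis using assms by simp
qed

text \<open>Half commutators are central and bilinear, so a half commutator nested as an argument
  disappears and both bracketings carry the same three corrections. Commutativity holds because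
  \<open>commutator x y\<close> is the square of \<open>half_commutator y x\<close>. Inverses are
  those of \<open>G\<close>, as \<open>x\<close> commutes with \<open>inv x\<close>.\<close>

lemma comm_group_baer: "comm_group baer"
proof (rule comm_groupI; unfold baer_simps)
  fix x y z assume x: "x \<in> carrier G" and y: "y \<in> carrier G" and z: "z \<in> carrier G"
  have "(x \<otimes> y \<otimes> half_commutator x y) \<otimes> z \<otimes> half_commutator (x \<otimes> y \<otimes> half_commutator x y) z
      = (x \<otimes> y \<otimes> half_commutator x y) \<otimes> z \<otimes> (half_commutator x z \<otimes> half_commutator y z)"
    using x y z by (simp add: half_commutator_mult_left half_commutator_central_left central_half_commutator)
  also have "\<dots> = x \<otimes> y \<otimes> (z \<otimes> half_commutator x y) \<otimes> (half_commutator x z \<otimes> half_commutator y z)"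
    using x y z half_commutator_commutes[of x y z] by (simp add: m_assoc)
  also have "x \<otimes> y \<otimes> (z \<otimes> half_commutator x y) \<otimes> (half_commutator x z \<otimes> half_commutator y z)
      = x \<otimes> y \<otimes> z \<otimes> (half_commutator x y \<otimes> half_commutator x z \<otimes> half_commutator y z)"
    using x y z by (simp add: m_assoc)
  also have "half_commutator x y \<otimes> half_commutator x z \<otimes> half_commutator y z
      = half_commutator y z \<otimes> (half_commutator x y \<otimes> half_commutator x z)"
    using x y z half_commutator_commutes[of y z "half_commutator x y \<otimes> half_commutator x z"] by simp
  also have "x \<otimes> y \<otimes> z \<otimes> (half_commutator y z \<otimes> (half_commutator x y \<otimes> half_commutator x z))
      = x \<otimes> (y \<otimes> z \<otimes> half_commutator y z) \<otimes> (half_commutator x y \<otimes> half_commutator x z)"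
    using x y z by (simp add: m_assoc)
  also have "half_commutator x y \<otimes> half_commutator x z = half_commutator x (y \<otimes> z \<otimes> half_commutator y z)"
    using x y z by (simp add: half_commutator_mult_right half_commutator_central_right central_half_commutator)
  finally show "(x \<otimes> y \<otimes> half_commutator x y) \<otimes> z \<otimes> half_commutator (x \<otimes> y \<otimes> half_commutator x y) z
      = x \<otimes> (y \<otimes> z \<otimes> half_commutator y z) \<otimes> half_commutator x (y \<otimes> z \<otimes> half_commutator y z)" .
next
  fix x y assume x: "x \<in> carrier G" and y: "y \<in> carrier G"
  have "x \<otimes> y \<otimes> half_commutator x y = y \<otimes> x \<otimes> (commutator x y \<otimes> half_commutator x y)"
    using x y commutator_swap[of x y] commutator_commutes[of x y "y \<otimes> x"] by (simp add: m_assoc)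
  also have "commutator x y = half_commutator y x \<otimes> half_commutator y x"
    using x y by (simp add: half_commutator_double)
  also have "half_commutator y x \<otimes> half_commutator y x \<otimes> half_commutator x y = half_commutator y x"
    using x y by (simp add: m_assoc half_commutator_swap)
  finally show "x \<otimes> y \<otimes> half_commutator x y = y \<otimes> x \<otimes> half_commutator y x" .
next
  fix x assume x: "x \<in> carrier G"
  show "\<one> \<otimes> x \<otimes> half_commutator \<one> x = x"
    using x by (simp add: half_commutator_central_left central_one)
  have "half_commutator (inv x) x = \<one>"
    using x commutator_eqI[of x "inv x" \<one>] by (simp add: half_commutator_def)
  then show "\<exists>y\<in>carrier G. y \<otimes> x \<otimes> half_commutator y x = \<one>"
    using x by (intro bexI[of _ "inv x"]) auto
qed auto

sublocale baer: comm_group baer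
  by (rule comm_group_baer)

section \<open>Characters of the Baer group on products, commutators and conjugates\<close>

context
  fixes \<nu> :: "'a \<Rightarrow> complex"
  assumes \<nu>: "linear_character baer \<nu>"
begin

lemma baer_character_one: "\<nu> \<one> = 1"
  using linear_character_one[OF \<nu>] by simp

lemma baer_character_nonzero: "x \<in> carrier G \<Longrightarrow> \<nu> x \<noteq> 0"
  using baer.linear_character_nonzero[OF \<nu>] by simp

text \<open>The half commutator with a central factor is trivial, so the two products agree
  here.\<close>

lemma baer_character_central:
  "central c \<Longrightarrow> x \<in> carrier G \<Longrightarrow> \<nu> (c \<otimes> x) = \<nu> c * \<nu> x"
  using linear_character_mult[OF \<nu>, of c x]
  by (simp add: half_commutator_central_left) (simp add: central_def)

lemma baer_character_central_pow:
  "central c \<Longrightarrow> \<nu> (c [^] (n::nat)) = \<nu> c ^ n"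
proof (induction n)
  case (Suc n)
  then have "central (c [^] n)" "c \<in> carrier G" by (auto simp: central_pow, simp add: central_def)
  then show ?case using Suc by (simp add: baer_character_central)
qed (simp add: baer_character_one)

text \<open>Commutators are bilinear with central values, and \<open>\<nu>\<close> respects the
  product of \<open>G\<close> when one factor is central.\<close>

lemma linear_character_commutator_left:
  "z \<in> carrier G \<Longrightarrow> linear_character G (\<lambda>x. \<nu> (commutator x z))"
  by (auto simp: linear_character_def commutator_mult_left baer_character_central central_commutator
      commutator_central_left central_one baer_character_one)

lemma linear_character_commutator_right:
  "z \<in> carrier G \<Longrightarrow> linear_character G (\<lambda>x. \<nu> (commutator z x))"
  by (auto simp: linear_character_def commutator_mult_right baer_character_central central_commutator
      commutator_central_right central_one baer_character_one)

text \<open>Half commutators are powers of commutators, so \<open>\<chi>\<close> is 1 on them and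
  does not distinguish the two products.\<close>

lemma baer_linear_character:
  assumes "linear_character G \<chi>" "\<And>x y. x \<in> carrier G \<Longrightarrow> y \<in> carrier G \<Longrightarrow> \<chi> (commutator x y) = 1"
  shows "linear_character baer \<chi>"
proof -
  have "\<chi> (half_commutator x y) = 1" if "x \<in> carrier G" "y \<in> carrier G" for x y
    using that assms linear_character_pow[OF assms(1)] by (simp add: half_commutator_def)
  then show ?thesis
    using assms(1) by (simp add: linear_character_def)
qed

lemma baer_commutator_left:
  "z \<in> carrier G \<Longrightarrow> linear_character baer (\<lambda>x. \<nu> (commutator x z))"
  by (intro baer_linear_character linear_character_commutator_left)
     (auto simp: commutator_central_left central_commutator baer_character_one)

lemma baer_commutator_right:
  "z \<in> carrier G \<Longrightarrow> linear_character baer (\<lambda>x. \<nu> (commutator z x))"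
  by (intro baer_linear_character linear_character_commutator_right)
     (auto simp: commutator_central_right central_commutator baer_character_one)

lemma baer_commutator_swap:
  assumes "x \<in> carrier G" "y \<in> carrier G"
  shows "\<nu> (commutator x y) * \<nu> (commutator y x) = 1"
proof -
  have "commutator x y \<otimes> commutator y x = \<one>"
    using r_inv[of "commutator x y"] assms by (simp add: commutator_inverse)
  then show ?thesis
    using baer_character_central[of "commutator x y" "commutator y x"] assms
    by (simp add: central_commutator baer_character_one)
qed

text \<open>The Baer product differs from that of \<open>G\<close> by the central factor
  \<open>half_commutator x y\<close>, on which \<open>\<nu>\<close> is a power of its value on a
  commutator. This is the source of the quadratic exponents of words.\<close>

lemma baer_character_mult:
  assumes "x \<in> carrier G" "y \<in> carrier G"
  shows "\<nu> (x \<otimes> y) = \<nu> x * \<nu> y * \<nu> (commutator x y) ^ half_exponent"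
proof -
  have "\<nu> x * \<nu> y = \<nu> (x \<otimes> y \<otimes> half_commutator x y)"
    using linear_character_mult[OF \<nu>, of x y] assms by simp
  also have "\<dots> = \<nu> (half_commutator x y) * \<nu> (x \<otimes> y)"
    using assms half_commutator_commutes[of x y "x \<otimes> y"]
      baer_character_central[OF central_half_commutator, of x y "x \<otimes> y"] by simp
  also have "\<nu> (half_commutator x y) = \<nu> (commutator y x) ^ half_exponent"
    unfolding half_commutator_def using assms by (intro baer_character_central_pow central_commutator)
  finally have "\<nu> x * \<nu> y * \<nu> (commutator x y) ^ half_exponent
      = (\<nu> (commutator x y) * \<nu> (commutator y x)) ^ half_exponent * \<nu> (x \<otimes> y)"
    by (simp add: power_mult_distrib mult_ac)
  then show ?thesis using assms by (simp add: baer_commutator_swap)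
qed

text \<open>Conjugation by \<open>x\<close> twists \<open>\<nu>\<close> by the linear character that
  the bicharacter attaches to \<open>x\<close>: this is the coadjoint action.\<close>

lemma baer_character_conj:
  assumes "x \<in> carrier G" "g \<in> carrier G"
  shows "\<nu> (x \<otimes> g \<otimes> inv x) = \<nu> (commutator x g) * \<nu> g"
proof -
  have "x \<otimes> g \<otimes> inv x = commutator x g \<otimes> g"
    using assms by (simp add: commutator_def m_assoc)
  then show ?thesis using assms by (simp add: baer_character_central central_commutator)
qed

end

end

section \<open>Fourier coefficients of word counts\<close>

lemma prod_power_add_delta:
  fixes f :: "'i \<Rightarrow> complex"
  assumes "finite A" "i \<in> A"
  shows "(\<Prod>j\<in>A. f j ^ (l j + (if j = i then s else 0))) = f i ^ s * (\<Prod>j\<in>A. f j ^ l j)"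
proof -
  have "(\<Prod>j\<in>A. f j ^ (if j = i then s else 0)) = (\<Prod>j\<in>A. if j = i then f j ^ s else 1)"
    by (intro prod.cong) auto
  then show ?thesis using assms by (simp add: power_add prod.distrib)
qed

context odd_class_two_group
begin

lemma baer_inv: "x \<in> carrier G \<Longrightarrow> inv\<^bsub>baer\<^esub> x = inv x"
  using commutator_eqI[of x "inv x" \<one>]
  by (intro baer.inv_equality) (auto simp: half_commutator_def)

lemma card_pos: "card (carrier G) > 0"
  using fin one_closed by (metis card_gt_0_iff empty_iff)

lemma baer_character_inv:
  assumes "linear_character baer \<nu>" "x \<in> carrier G"
  shows "\<nu> (inv x) = inverse (\<nu> x)"
  using baer.linear_character_inv[OF assms(1)] assms(2) by (simp add: baer_inv)

text \<open>The exponent -1 of an inverse letter is represented modulo the group order.\<close>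

definition letter_exponent :: "letter \<Rightarrow> nat" where
  "letter_exponent b = (if snd b then 1 else card (carrier G) - 1)"

lemma linear_character_letter:
  assumes "linear_character G \<chi>" "gs (fst b) \<in> carrier G"
  shows "\<chi> (letter_value G gs b) = \<chi> (gs (fst b)) ^ letter_exponent b"
  using assms linear_character_power_card[OF assms(1)]
  by (simp add: letter_value_def letter_exponent_def linear_character_inv root_of_unity_inverse[OF _ card_pos])

lemma baer_character_letter:
  assumes "linear_character baer \<nu>" "gs (fst b) \<in> carrier G"
  shows "\<nu> (letter_value G gs b) = \<nu> (gs (fst b)) ^ letter_exponent b"
  using assms baer.linear_character_power_card[OF assms(1)]
  by (simp add: letter_value_def letter_exponent_def baer_character_inv root_of_unity_inverse[OF _ card_pos])

text \<open>Each further letter contributes a commutator term by \<open>baer_character_mult\<close>.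
  The first clause is carried through the induction to expand that term, which is a linear character
  of \<open>G\<close> in the rest of the word. The exponents are the same for all tuples, so that
  summing over tuples gives an exponential sum.\<close>

lemma character_word_value:
  assumes \<nu>: "linear_character baer \<nu>" and "fst ` set u \<subseteq> {..<k}"
  shows "\<exists>l a. (\<forall>\<chi> gs. linear_character G \<chi> \<longrightarrow> gs \<in> {..<k} \<rightarrow> carrier G \<longrightarrow>
           \<chi> (word_value G gs u) = (\<Prod>i<k. \<chi> (gs i) ^ l i)) \<and>
         (\<forall>gs \<in> {..<k} \<rightarrow> carrier G. \<nu> (word_value G gs u) =
           (\<Prod>i<k. \<nu> (gs i) ^ l i) * (\<Prod>i<k. \<Prod>j<k. \<nu> (commutator (gs i) (gs j)) ^ a i j))"
  using assms(2)
proof (induction u)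
  case Nil
  show ?case
    by (intro exI[of _ "\<lambda>_. 0"] exI[of _ "\<lambda>_ _. 0"])
       (simp add: word_value_def linear_character_one baer_character_one[OF \<nu>])
next
  case (Cons b u)
  define i where "i = fst b"
  define s where "s = letter_exponent b"
  have i: "i < k" and u: "fst ` set u \<subseteq> {..<k}" using Cons.prems by (auto simp: i_def)
  obtain l a
    where l: "\<And>\<chi> gs. linear_character G \<chi> \<Longrightarrow> gs \<in> {..<k} \<rightarrow> carrier G \<Longrightarrow>
                \<chi> (word_value G gs u) = (\<Prod>i<k. \<chi> (gs i) ^ l i)"
      and a: "\<And>gs. gs \<in> {..<k} \<rightarrow> carrier G \<Longrightarrow> \<nu> (word_value G gs u) =
           (\<Prod>i<k. \<nu> (gs i) ^ l i) * (\<Prod>i<k. \<Prod>j<k. \<nu> (commutator (gs i) (gs j)) ^ a i j)"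
    using Cons.IH[OF u] by blast
  define l' where "l' j = l j + (if j = i then s else 0)" for j
  \<comment> \<open>The new letter acts as \<open>gs i\<close> to the power \<open>s\<close>. Its
    commutator with the rest of the word pairs \<open>gs i\<close> with \<open>gs j\<close> to the
    power \<open>l j * s\<close>, which is then halved.\<close>
  define a' where "a' r j = a r j + (if r = i then l j * (s * half_exponent) else 0)" for r j
  have value_Cons: "word_value G gs (b # u) = letter_value G gs b \<otimes> word_value G gs u" for gs
    by (simp add: word_value_def)
  have closed: "gs i \<in> carrier G" "letter_value G gs b \<in> carrier G" "word_value G gs u \<in> carrier G"
    if "gs \<in> {..<k} \<rightarrow> carrier G" for gs
    using that i word_value_closed[OF that u] by (auto simp: i_def Pi_iff intro: letter_value_closed)
  have "\<chi> (word_value G gs (b # u)) = (\<Prod>i<k. \<chi> (gs i) ^ l' i)"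
    if \<chi>: "linear_character G \<chi>" and gs: "gs \<in> {..<k} \<rightarrow> carrier G" for \<chi> gs
    using closed[OF gs] linear_character_letter[OF \<chi>, of gs b] i
    by (simp add: value_Cons linear_character_mult[OF \<chi>] l[OF \<chi> gs] l'_def prod_power_add_delta s_def i_def)
  moreover have "\<nu> (word_value G gs (b # u)) =
      (\<Prod>i<k. \<nu> (gs i) ^ l' i) * (\<Prod>i<k. \<Prod>j<k. \<nu> (commutator (gs i) (gs j)) ^ a' i j)"
    if gs: "gs \<in> {..<k} \<rightarrow> carrier G" for gs
  proof -
    let ?x = "letter_value G gs b" and ?v = "word_value G gs u"
    let ?B = "\<lambda>r j. \<nu> (commutator (gs r) (gs j))"
    note cl = closed[OF gs]
    have "\<nu> (commutator ?x ?v) = \<nu> (commutator (gs i) ?v) ^ s"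
      using linear_character_letter[OF linear_character_commutator_left[OF \<nu> cl(3)], of gs b] cl
      by (simp add: s_def i_def)
    also have "\<nu> (commutator (gs i) ?v) = (\<Prod>j<k. ?B i j ^ l j)"
      using l[OF linear_character_commutator_right[OF \<nu> cl(1)] gs] .
    finally have 1: "\<nu> (commutator ?x ?v) ^ half_exponent = (\<Prod>j<k. ?B i j ^ (l j * (s * half_exponent)))"
      by (simp add: power_mult prod_power_distrib)
    have "(\<Prod>r<k. \<Prod>j<k. ?B r j ^ a' r j)
        = (\<Prod>r<k. (\<Prod>j<k. ?B r j ^ a r j) * (if r = i then \<Prod>j<k. ?B i j ^ (l j * (s * half_exponent)) else 1))"
      by (intro prod.cong refl) (auto simp: a'_def power_add prod.distrib)
    also have "\<dots> = (\<Prod>r<k. \<Prod>j<k. ?B r j ^ a r j) * (\<Prod>j<k. ?B i j ^ (l j * (s * half_exponent)))"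
      using i by (simp add: prod.distrib)
    finally have 2: "(\<Prod>r<k. \<Prod>j<k. ?B r j ^ a' r j)
        = (\<Prod>r<k. \<Prod>j<k. ?B r j ^ a r j) * \<nu> (commutator ?x ?v) ^ half_exponent"
      unfolding 1 .
    have 3: "(\<Prod>i<k. \<nu> (gs i) ^ l' i) = \<nu> ?x * (\<Prod>i<k. \<nu> (gs i) ^ l i)"
      using i cl baer_character_letter[OF \<nu>, of gs b]
      by (simp add: l'_def prod_power_add_delta s_def i_def)
    show ?thesis
      unfolding value_Cons baer_character_mult[OF \<nu> cl(2,3)] a[OF gs] 2 3 by (simp only: mult_ac)
  qed
  ultimately show ?case by blast
qed

lemma sum_word_count:
  fixes f :: "'a \<Rightarrow> complex"
  assumes "fst ` set w \<subseteq> {..<k}"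
  shows "(\<Sum>x\<in>carrier G. of_nat (word_count G k w x) * f x)
       = (\<Sum>gs\<in>{..<k} \<rightarrow>\<^sub>E carrier G. f (word_value G gs w))"
proof -
  let ?T = "{..<k} \<rightarrow>\<^sub>E carrier G"
  have *: "(\<Sum>x\<in>carrier G. \<Sum>gs\<in>{gs \<in> ?T. word_value G gs w = x}. f (word_value G gs w))
      = (\<Sum>gs\<in>?T. f (word_value G gs w))"
    using fin word_value_closed[OF _ assms] by (intro sum.group finite_PiE) auto
  have "(\<Sum>gs\<in>{gs \<in> ?T. word_value G gs w = x}. f (word_value G gs w))
      = of_nat (word_count G k w x) * f x" for x
    by (simp add: word_count_def)
  then show ?thesis using * by (simp only:)
qed

text \<open>Sorting tuples by the value of the word gives an exponential sum on the Baer group, in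
  which \<open>\<nu>\<close> supplies the linear part and its bicharacter the alternating part.
  Since \<open>k \<ge> 1\<close>, there is a variable, and the group order divides the constant
  \<open>C\<close>.\<close>

lemma word_count_coefficient:
  assumes p: "prime p" and card: "card (carrier G) = p ^ e" and "k \<ge> 1"
    and w: "fst ` set w \<subseteq> {..<k}" and \<nu>: "linear_character baer \<nu>"
  shows "\<exists>m. (\<Sum>x\<in>carrier G. of_nat (word_count G k w x) * \<nu> x) = of_nat (card (carrier G) * m)"
proof -
  let ?\<beta> = "\<lambda>x y. \<nu> (commutator x y)"
  obtain l a where la: "\<And>gs. gs \<in> {..<k} \<rightarrow> carrier G \<Longrightarrow> \<nu> (word_value G gs w) =
      (\<Prod>i<k. \<nu> (gs i) ^ l i) * (\<Prod>i<k. \<Prod>j<k. ?\<beta> (gs i) (gs j) ^ a i j)"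
    using character_word_value[OF \<nu> w] by blast
  have "\<exists>C K. K \<subseteq> carrier baer \<and> ({..<k} = {} \<and> K = {} \<or> card (carrier baer) dvd C) \<and>
     (\<forall>\<theta>. linear_character baer \<theta> \<longrightarrow>
       (\<Sum>g\<in>{..<k} \<rightarrow>\<^sub>E carrier baer. (\<Prod>i<k. \<theta> (g i) ^ l i) * (\<Prod>i<k. \<Prod>j<k. ?\<beta> (g i) (g j) ^ a i j))
         = (if \<forall>x\<in>K. \<theta> x = 1 then of_nat C else 0))"
    using fin p card baer_commutator_left[OF \<nu>] baer_commutator_right[OF \<nu>] baer_character_one[OF \<nu>]
    by (intro baer.sum_alternating_bicharacter[of p e]) (auto simp: commutator_self)
  then obtain C K where C: "card (carrier G) dvd C"
    and CK: "(\<Sum>g\<in>{..<k} \<rightarrow>\<^sub>E carrier G. (\<Prod>i<k. \<nu> (g i) ^ l i) * (\<Prod>i<k. \<Prod>j<k. ?\<beta> (g i) (g j) ^ a i j))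
         = (if \<forall>x\<in>K. \<nu> x = 1 then of_nat C else 0)"
    using \<open>k \<ge> 1\<close> \<nu> by (auto simp: lessThan_empty_iff)
  have "(\<Sum>x\<in>carrier G. of_nat (word_count G k w x) * \<nu> x)
      = (\<Sum>gs\<in>{..<k} \<rightarrow>\<^sub>E carrier G. \<nu> (word_value G gs w))"
    by (rule sum_word_count[OF w])
  also have "\<dots> = (\<Sum>g\<in>{..<k} \<rightarrow>\<^sub>E carrier G.
      (\<Prod>i<k. \<nu> (g i) ^ l i) * (\<Prod>i<k. \<Prod>j<k. ?\<beta> (g i) (g j) ^ a i j))"
    by (intro sum.cong refl la) auto
  also have "\<dots> = (if \<forall>x\<in>K. \<nu> x = 1 then of_nat C else 0)" by (rule CK)
  also have "\<dots> = of_nat (card (carrier G) * (if \<forall>x\<in>K. \<nu> x = 1 then C div card (carrier G) else 0))"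
    using dvd_mult_div_cancel[OF C] by (auto simp del: of_nat_mult)
  finally show ?thesis by blast
qed

section \<open>Conjugation invariance of word counts\<close>

lemma conj_closed_inverse:
  assumes "x \<in> carrier G" "y \<in> carrier G"
  shows "inv x \<otimes> (x \<otimes> y \<otimes> inv x) \<otimes> x = y" "x \<otimes> (inv x \<otimes> y \<otimes> x) \<otimes> inv x = y"
  using assms by (simp_all add: m_assoc cancel)

text \<open>Evaluation followed by conjugation is a homomorphism on the free group, hence determined
  by the generators.\<close>

lemma word_value_conj:
  assumes x: "x \<in> carrier G" and gs: "gs \<in> {..<k} \<rightarrow> carrier G" and w: "w \<in> carrier (free_group k)"
  shows "word_value G (\<lambda>i\<in>{..<k}. x \<otimes> gs i \<otimes> inv x) w = x \<otimes> word_value G gs w \<otimes> inv x"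
proof -
  note hom = word_value_hom[OF gs]
  have cl: "word_value G gs u \<in> carrier G" if "u \<in> carrier (free_group k)" for u
    using hom that by (auto simp: hom_def)
  have "(\<lambda>u. x \<otimes> word_value G gs u \<otimes> inv x) \<in> hom (free_group k) G"
    using x cl hom_mult[OF hom] by (intro homI) (simp_all add: m_assoc cancel)
  then show ?thesis
    using w x gs by (intro word_value_unique[symmetric]) (auto simp: word_value_generator Pi_iff)
qed

text \<open>Conjugating all entries of a tuple injects one fibre into the other; conjugation by the
  inverse gives the reverse inequality.\<close>

lemma word_count_conj:
  assumes x: "x \<in> carrier G" and g: "g \<in> carrier G" and w: "w \<in> carrier (free_group k)"
  shows "word_count G k w (x \<otimes> g \<otimes> inv x) = word_count G k w g"
proof -
  have le: "word_count G k w g \<le> word_count G k w (x \<otimes> g \<otimes> inv x)"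
    if x: "x \<in> carrier G" and g: "g \<in> carrier G" for x g
    unfolding word_count_def
  proof (rule card_inj_on_le)
    let ?f = "\<lambda>gs. \<lambda>i\<in>{..<k}. x \<otimes> gs i \<otimes> inv x"
    show "inj_on ?f {gs \<in> {..<k} \<rightarrow>\<^sub>E carrier G. word_value G gs w = g}"
    proof (rule inj_onI)
      fix gs hs assume gs: "gs \<in> {gs \<in> {..<k} \<rightarrow>\<^sub>E carrier G. word_value G gs w = g}"
        and hs: "hs \<in> {gs \<in> {..<k} \<rightarrow>\<^sub>E carrier G. word_value G gs w = g}" and eq: "?f gs = ?f hs"
      show "gs = hs"
      proof (rule PiE_ext[of gs "{..<k}" "\<lambda>_. carrier G" hs])
        show "gs \<in> {..<k} \<rightarrow>\<^sub>E carrier G" "hs \<in> {..<k} \<rightarrow>\<^sub>E carrier G" using gs hs by simp_all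
        fix i assume i: "i \<in> {..<k}"
        have "x \<otimes> gs i \<otimes> inv x = x \<otimes> hs i \<otimes> inv x" using fun_cong[OF eq, of i] i by simp
        moreover have "gs i \<in> carrier G" "hs i \<in> carrier G" using gs hs i by auto
        ultimately show "gs i = hs i" using x conj_closed_inverse(1) by metis
      qed
    qed
    show "?f ` {gs \<in> {..<k} \<rightarrow>\<^sub>E carrier G. word_value G gs w = g}
        \<subseteq> {gs \<in> {..<k} \<rightarrow>\<^sub>E carrier G. word_value G gs w = x \<otimes> g \<otimes> inv x}"
    proof
      fix hs assume "hs \<in> ?f ` {gs \<in> {..<k} \<rightarrow>\<^sub>E carrier G. word_value G gs w = g}"
      then obtain gs where gs: "gs \<in> {..<k} \<rightarrow>\<^sub>E carrier G" "word_value G gs w = g" "hs = ?f gs" by auto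
      have "gs \<in> {..<k} \<rightarrow> carrier G" using gs(1) by auto
      then have "word_value G hs w = x \<otimes> g \<otimes> inv x"
        using word_value_conj[OF x _ w] gs by simp
      moreover have "hs \<in> {..<k} \<rightarrow>\<^sub>E carrier G" using gs x by auto
      ultimately show "hs \<in> {gs \<in> {..<k} \<rightarrow>\<^sub>E carrier G. word_value G gs w = x \<otimes> g \<otimes> inv x}" by simp
    qed
    show "finite {gs \<in> {..<k} \<rightarrow>\<^sub>E carrier G. word_value G gs w = x \<otimes> g \<otimes> inv x}"
      using fin by (intro finite_subset[OF _ finite_PiE[of "{..<k}" "\<lambda>_. carrier G"]]) auto
  qed
  from le[of "inv x" "x \<otimes> g \<otimes> inv x"] le[OF x g] x g show ?thesis
    by (simp add: conj_closed_inverse)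
qed

section \<open>The radical, polarizations and the irreducible character attached to
  \<open>\<nu>\<close>\<close>

definition radical :: "('a \<Rightarrow> complex) \<Rightarrow> 'a set" where
  "radical \<nu> = {g \<in> carrier G. \<forall>x\<in>carrier G. \<nu> (commutator x g) = 1}"

lemma radical_inverse: "radical (\<lambda>x. inverse (\<nu> x)) = radical \<nu>"
  by (simp add: radical_def)

context
  fixes \<nu> :: "'a \<Rightarrow> complex"
  assumes \<nu>: "linear_character baer \<nu>"
begin

lemma sum_commutator:
  assumes "g \<in> carrier G"
  shows "(\<Sum>x\<in>carrier G. \<nu> (commutator x g)) = (if g \<in> radical \<nu> then of_nat (card (carrier G)) else 0)"
  using assms linear_character_commutator_left[OF \<nu> assms]
  by (subst sum_linear_character[OF subgroup_self]) (auto simp: radical_def linear_character_def)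

lemma central_in_radical: "central c \<Longrightarrow> c \<in> radical \<nu>"
  by (simp add: radical_def commutator_central_right baer_character_one[OF \<nu>]) (simp add: central_def)

lemma radical_subgroup: "subgroup (radical \<nu>) G"
proof (rule subgroupI)
  show "radical \<nu> \<noteq> {}" using central_in_radical[OF central_one] by auto
qed (auto simp: radical_def linear_character_inv[OF linear_character_commutator_right[OF \<nu>]]
      linear_character_mult[OF linear_character_commutator_right[OF \<nu>]])

text \<open>Replacing \<open>y\<close> by a conjugate multiplies its term by
  \<open>\<nu> (commutator x y)\<close>, and averaging over \<open>x\<close> removes the terms off
  the radical. Fourier coefficients of class functions thus depend only on the restriction to the
  radical.\<close>

lemma sum_class_function:
  assumes f: "\<And>x g. x \<in> carrier G \<Longrightarrow> g \<in> carrier G \<Longrightarrow> f (x \<otimes> g \<otimes> inv x) = f g"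
  shows "(\<Sum>y\<in>carrier G. f y * \<nu> y) = (\<Sum>y\<in>radical \<nu>. f y * \<nu> y)"
proof -
  have "(\<Sum>y\<in>carrier G. f y * \<nu> y) = (\<Sum>y\<in>carrier G. f y * \<nu> y * \<nu> (commutator x y))"
    if x: "x \<in> carrier G" for x
  proof -
    have "(\<Sum>y\<in>carrier G. f y * \<nu> y) = (\<Sum>y\<in>carrier G. f (x \<otimes> y \<otimes> inv x) * \<nu> (x \<otimes> y \<otimes> inv x))"
      by (rule sum.reindex_bij_witness[of _ "\<lambda>y. x \<otimes> y \<otimes> inv x" "\<lambda>y. inv x \<otimes> y \<otimes> x"])
        (use x in \<open>auto simp: conj_closed_inverse\<close>)
    also have "\<dots> = (\<Sum>y\<in>carrier G. f y * \<nu> y * \<nu> (commutator x y))"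
      using x by (intro sum.cong refl) (simp add: f baer_character_conj[OF \<nu>])
    finally show ?thesis .
  qed
  then have "(\<Sum>x\<in>carrier G. \<Sum>y\<in>carrier G. f y * \<nu> y)
      = (\<Sum>x\<in>carrier G. \<Sum>y\<in>carrier G. f y * \<nu> y * \<nu> (commutator x y))"
    by (rule sum.cong[OF refl])
  also have "\<dots> = (\<Sum>y\<in>carrier G. f y * \<nu> y * (\<Sum>x\<in>carrier G. \<nu> (commutator x y)))"
    by (subst sum.swap) (simp only: sum_distrib_left)
  also have "\<dots> = (\<Sum>y\<in>carrier G. if y \<in> radical \<nu> then of_nat (card (carrier G)) * (f y * \<nu> y) else 0)"
    by (intro sum.cong refl) (simp add: sum_commutator)
  also have "\<dots> = (\<Sum>y\<in>radical \<nu>. of_nat (card (carrier G)) * (f y * \<nu> y))"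
    using fin by (intro sum.mono_neutral_cong_right) (auto simp: radical_def)
  finally have "of_nat (card (carrier G)) * (\<Sum>y\<in>carrier G. f y * \<nu> y)
      = of_nat (card (carrier G)) * (\<Sum>y\<in>radical \<nu>. f y * \<nu> y)"
    by (simp add: sum_distrib_left)
  then show ?thesis using card_pos by simp
qed

text \<open>A maximal isotropic subset contains every \<open>x\<close> orthogonal to it, since the
  form is alternating and adding \<open>x\<close> keeps the set isotropic. Maximality is taken among
  subsets; self-orthogonality later makes \<open>M\<close> a subgroup.\<close>

lemma ex_polarization:
  obtains M where "M \<subseteq> carrier G"
    and "\<And>x. x \<in> carrier G \<Longrightarrow> x \<in> M \<longleftrightarrow> (\<forall>m\<in>M. \<nu> (commutator x m) = 1)"
proof -
  define isotropic where "isotropic = {A. A \<subseteq> carrier G \<and> (\<forall>x\<in>A. \<forall>y\<in>A. \<nu> (commutator x y) = 1)}"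
  have "finite isotropic" "{} \<in> isotropic"
    using finite_subset[of isotropic "Pow (carrier G)"] by (auto simp: isotropic_def fin)
  then obtain M where "M \<in> isotropic" and max: "\<And>A. A \<in> isotropic \<Longrightarrow> M \<subseteq> A \<Longrightarrow> M = A"
    using finite_has_maximal[of isotropic] by blast
  then have sub: "M \<subseteq> carrier G" and M: "\<And>x y. x \<in> M \<Longrightarrow> y \<in> M \<Longrightarrow> \<nu> (commutator x y) = 1"
    by (auto simp: isotropic_def)
  have "x \<in> M" if x: "x \<in> carrier G" and xM: "\<forall>m\<in>M. \<nu> (commutator x m) = 1" for x
  proof -
    have "\<nu> (commutator m x) = 1" if "m \<in> M" for m
      using baer_commutator_swap[OF \<nu> x, of m] that xM sub by auto
    then have "insert x M \<in> isotropic"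
      using M sub x xM by (simp add: isotropic_def commutator_self baer_character_one[OF \<nu>])
    then show ?thesis using max[of "insert x M"] by auto
  qed
  then show ?thesis using M sub by (intro that[of M]) auto
qed

text \<open>A polarization \<open>M\<close> is a normal subgroup on which \<open>\<nu>\<close> is
  multiplicative, and self-orthogonality says that the stabilizer of this restriction lies in
  \<open>M\<close>, so Mackey's criterion applies. The degree \<open>d\<close> is the index of
  \<open>M\<close>.\<close>

lemma ex_irreducible_character:
  "\<exists>d. d * d * card (radical \<nu>) = card (carrier G) \<and>
     (\<lambda>g\<in>carrier G. if g \<in> radical \<nu> then of_nat d * \<nu> g else 0) \<in> irr_characters G"
proof -
  obtain M where sub: "M \<subseteq> carrier G"
    and M: "\<And>x. x \<in> carrier G \<Longrightarrow> x \<in> M \<longleftrightarrow> (\<forall>m\<in>M. \<nu> (commutator x m) = 1)"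
    using ex_polarization by blast
  note left = linear_character_commutator_left[OF \<nu>]
  have swap: "\<nu> (commutator x y) = 1 \<longleftrightarrow> \<nu> (commutator y x) = 1"
    if "x \<in> carrier G" "y \<in> carrier G" for x y
    using baer_commutator_swap[OF \<nu> that] by auto
  have MM: "\<nu> (commutator x m) = 1" if "x \<in> M" "m \<in> M" for x m
    using that M[of x] sub by auto
  have Msub: "subgroup M G"
  proof (rule subgroupI)
    have "\<one> \<in> M" using M[of \<one>] sub by (auto simp: commutator_central_left central_one baer_character_one[OF \<nu>])
    then show "M \<noteq> {}" by auto
  next
    fix x y assume "x \<in> M" "y \<in> M"
    then show "x \<otimes> y \<in> M"
      using sub by (subst M) (auto simp: subset_iff linear_character_mult[OF left] MM)
  next
    fix x assume "x \<in> M"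
    then show "inv x \<in> M"
      using sub by (subst M) (auto simp: subset_iff linear_character_inv[OF left] MM)
  qed (rule sub)
  have rad_M: "radical \<nu> \<subseteq> M" using M sub swap by (auto simp: radical_def subset_iff)
  \<comment> \<open>In its first argument the form is a linear character of \<open>G\<close>, hence
    invariant under conjugation.\<close>
  have conj: "inv x \<otimes> g \<otimes> x \<in> M \<longleftrightarrow> g \<in> M" if "x \<in> carrier G" "g \<in> carrier G" for x g
  proof -
    have "\<nu> (commutator (inv x \<otimes> g \<otimes> x) m) = \<nu> (commutator g m)" if "m \<in> M" for m
    proof -
      have "m \<in> carrier G" using that sub by auto
      then show ?thesis
        using \<open>x \<in> carrier G\<close> \<open>g \<in> carrier G\<close> linear_character_nonzero[OF left, of m x]
        by (simp add: linear_character_mult[OF left] linear_character_inv[OF left])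
    qed
    then show ?thesis using M[of g] M[of "inv x \<otimes> g \<otimes> x"] that by auto
  qed
  have \<nu>_conj: "\<nu> (inv x \<otimes> g \<otimes> x) = \<nu> (commutator (inv x) g) * \<nu> g"
    if "x \<in> carrier G" "g \<in> carrier G" for x g
    using baer_character_conj[OF \<nu>, of "inv x" g] that by simp
  have "(\<lambda>g\<in>carrier G. (\<Sum>x\<in>carrier G. if inv x \<otimes> g \<otimes> x \<in> M then \<nu> (inv x \<otimes> g \<otimes> x) else 0)
           / of_nat (card M)) \<in> irr_characters G"
  proof (rule induced_irreducible[OF fin Msub])
    fix x assume x: "x \<in> carrier G" and st: "\<And>m. m \<in> M \<Longrightarrow> \<nu> (inv x \<otimes> m \<otimes> x) = \<nu> m"
    have "\<nu> (commutator (inv x) m) = 1" if m: "m \<in> M" for m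
    proof -
      have mG: "m \<in> carrier G" using m sub by auto
      then show ?thesis using st[OF m] \<nu>_conj[OF x mG] baer_character_nonzero[OF \<nu> mG] by simp
    qed
    then have "inv x \<in> M" using M[of "inv x"] x by auto
    then have "inv (inv x) \<in> M" by (rule subgroup.m_inv_closed[OF Msub])
    then show "x \<in> M" using x by simp
  next
    fix x y assume xy: "x \<in> M" "y \<in> M"
    then have "x \<in> carrier G" "y \<in> carrier G" "\<nu> (commutator x y) = 1" using sub M by auto
    then show "\<nu> (x \<otimes> y) = \<nu> x * \<nu> y" by (simp add: baer_character_mult[OF \<nu>])
  next
    fix x m assume "x \<in> carrier G" "m \<in> M"
    then show "inv x \<otimes> m \<otimes> x \<in> M" using conj[of x m] sub by auto
  qed (rule baer_character_one[OF \<nu>])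
  moreover obtain d where d: "d * card M = card (carrier G)"
    using lagrange[OF Msub] by (auto simp: Coset.order_def)
  have cM: "card M > 0" using d card_pos by (cases "card M") auto
  \<comment> \<open>For \<open>g\<close> in \<open>M\<close> every term is \<open>\<nu> g\<close>
    times a value of the form, and the sum of these values vanishes off the radical. For
    \<open>g\<close> outside \<open>M\<close> all terms are zero by normality.\<close>
  have "(\<Sum>x\<in>carrier G. if inv x \<otimes> g \<otimes> x \<in> M then \<nu> (inv x \<otimes> g \<otimes> x) else 0) / of_nat (card M)
      = (if g \<in> radical \<nu> then of_nat d * \<nu> g else 0)" if g: "g \<in> carrier G" for g
  proof (cases "g \<in> M")
    case True
    have "(\<Sum>x\<in>carrier G. if inv x \<otimes> g \<otimes> x \<in> M then \<nu> (inv x \<otimes> g \<otimes> x) else 0)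
        = (\<Sum>x\<in>carrier G. \<nu> (commutator (inv x) g) * \<nu> g)"
      using True g by (intro sum.cong refl) (simp add: conj \<nu>_conj)
    also have "\<dots> = (\<Sum>x\<in>carrier G. \<nu> (commutator (inv x) g)) * \<nu> g"
      by (simp only: sum_distrib_right)
    also have "(\<Sum>x\<in>carrier G. \<nu> (commutator (inv x) g)) = (\<Sum>x\<in>carrier G. \<nu> (commutator x g))"
      by (rule sum.reindex_bij_witness[of _ "\<lambda>x. inv x" "\<lambda>x. inv x"]) auto
    finally show ?thesis
      using cM g by (simp add: sum_commutator flip: d)
  next
    case False
    then show ?thesis using rad_M g by (auto simp: conj)
  qed
  then have "(\<lambda>g\<in>carrier G. (\<Sum>x\<in>carrier G. if inv x \<otimes> g \<otimes> x \<in> M then \<nu> (inv x \<otimes> g \<otimes> x) else 0)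
           / of_nat (card M)) = (\<lambda>g\<in>carrier G. if g \<in> radical \<nu> then of_nat d * \<nu> g else 0)"
    by (intro restrict_ext)
  moreover have "d * d * card (radical \<nu>) = card (carrier G)"
  proof -
    \<comment> \<open>Summing the form over the group first leaves the radical, summing over
      \<open>M\<close> first leaves \<open>M\<close>; comparison gives the order of the radical
      times \<open>d\<close> as the order of \<open>M\<close>.\<close>
    have "(\<Sum>m\<in>M. \<Sum>x\<in>carrier G. \<nu> (commutator x m)) = (\<Sum>m\<in>M. if m \<in> radical \<nu> then of_nat (card (carrier G)) else 0)"
      using sub by (intro sum.cong refl sum_commutator) auto
    also have "\<dots> = (\<Sum>m\<in>radical \<nu>. of_nat (card (carrier G)))"
      using rad_M finite_subset[OF sub fin] by (intro sum.mono_neutral_cong_right) auto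
    also have "\<dots> = of_nat (card (radical \<nu>) * card (carrier G))" by simp
    finally have 1: "(\<Sum>m\<in>M. \<Sum>x\<in>carrier G. \<nu> (commutator x m)) = of_nat (card (radical \<nu>) * card (carrier G))" .
    have "(\<Sum>m\<in>M. \<nu> (commutator x m)) = (if x \<in> M then of_nat (card M) else 0)" if "x \<in> carrier G" for x
      using linear_character_commutator_right[OF \<nu> that] M[OF that] sub
      by (subst sum_linear_character[OF Msub]) (auto simp: linear_character_def subset_iff)
    then have "(\<Sum>x\<in>carrier G. \<Sum>m\<in>M. \<nu> (commutator x m)) = (\<Sum>x\<in>carrier G. if x \<in> M then of_nat (card M) else 0)"
      by (intro sum.cong refl) simp
    also have "\<dots> = (\<Sum>x\<in>M. of_nat (card M))"
      using sub fin by (intro sum.mono_neutral_cong_right) auto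
    also have "\<dots> = of_nat (card M * card M)" by simp
    finally have "(of_nat (card (radical \<nu>) * card (carrier G)) :: complex) = of_nat (card M * card M)"
      using 1 by (subst (asm) sum.swap) simp
    then have "card (radical \<nu>) * (d * card M) = card M * card M" by (simp only: of_nat_eq_iff d)
    then have *: "card (radical \<nu>) * d = card M" using cM by simp
    have "d * d * card (radical \<nu>) = d * (card (radical \<nu>) * d)" by simp
    then show ?thesis unfolding * d .
  qed
  ultimately show ?thesis by (intro exI[of _ d] conjI) (simp_all only:)
qed

end

text \<open>The sum of \<open>\<mu> r * inverse (\<nu> r)\<close> over all \<open>\<mu>\<close> and
  all \<open>r\<close> in the radical is evaluated in both orders: summing over \<open>r\<close>
  first counts the extensions, summing over \<open>\<mu>\<close> first leaves only the
  identity.\<close>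

lemma card_extensions:
  assumes \<nu>: "linear_character baer \<nu>"
  shows "card {\<mu> \<in> linear_characters baer. \<forall>r\<in>radical \<nu>. \<mu> r = \<nu> r} * card (radical \<nu>) = card (carrier G)"
proof -
  let ?X = "linear_characters baer" and ?R = "radical \<nu>"
  let ?F = "{\<mu> \<in> ?X. \<forall>r\<in>?R. \<mu> r = \<nu> r}"
  have R: "?R \<subseteq> carrier G" by (auto simp: radical_def)
  have finX: "finite ?X" using baer.finite_linear_characters fin by simp
  have \<nu>0: "\<nu> r \<noteq> 0" if "r \<in> ?R" for r using baer_character_nonzero[OF \<nu>] R that by auto
  have char: "(\<Sum>r\<in>?R. \<mu> r * inverse (\<nu> r)) = (if \<mu> \<in> ?F then of_nat (card ?R) else 0)" if \<mu>: "\<mu> \<in> ?X" for \<mu>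
  proof -
    let ?q = "\<lambda>r. \<mu> r * inverse (\<nu> r)"
    have l: "linear_character baer \<mu>" using \<mu> by (simp add: linear_characters_def)
    \<comment> \<open>The correction in a Baer product is central, hence in the radical.\<close>
    have B: "subgroup ?R baer"
    proof (rule baer.subgroupI)
      interpret R: subgroup ?R G by (rule radical_subgroup[OF \<nu>])
      show "?R \<subseteq> carrier baer" using R by simp
      show "?R \<noteq> {}" using R.one_closed by blast
      show "inv\<^bsub>baer\<^esub> a \<in> ?R" if "a \<in> ?R" for a
        using that R by (auto simp: baer_inv subset_iff)
      show "a \<otimes>\<^bsub>baer\<^esub> b \<in> ?R" if "a \<in> ?R" "b \<in> ?R" for a b
      proof -
        have ab: "a \<in> carrier G" "b \<in> carrier G" using that R by auto
        then have "half_commutator a b \<in> ?R"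
          by (intro central_in_radical[OF \<nu>] central_half_commutator)
        then show ?thesis using R.m_closed[OF R.m_closed[OF that]] by simp
      qed
    qed
    have "(\<Sum>r\<in>?R. ?q r) = (if \<forall>r\<in>?R. ?q r = 1 then of_nat (card ?R) else 0)"
      using R by (intro baer.sum_linear_character[OF B] linear_character_mult[of baer]
          linear_character_times[OF l] linear_character_inverse \<nu>) auto
    also have "(\<forall>r\<in>?R. ?q r = 1) \<longleftrightarrow> \<mu> \<in> ?F"
      using \<mu> \<nu>0 by (auto simp: field_simps)
    finally show ?thesis .
  qed
  have "(\<Sum>\<mu>\<in>?X. \<Sum>r\<in>?R. \<mu> r * inverse (\<nu> r)) = (\<Sum>\<mu>\<in>?X. if \<mu> \<in> ?F then of_nat (card ?R) else 0)"
    by (intro sum.cong refl char)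
  also have "\<dots> = (\<Sum>\<mu>\<in>?F. of_nat (card ?R))"
    using finX by (intro sum.mono_neutral_cong_right) auto
  finally have 1: "(\<Sum>\<mu>\<in>?X. \<Sum>r\<in>?R. \<mu> r * inverse (\<nu> r)) = of_nat (card ?F * card ?R)" by simp
  have one: "\<one> \<in> ?R" using subgroup.one_closed[OF radical_subgroup[OF \<nu>]] .
  have "(\<Sum>r\<in>?R. \<Sum>\<mu>\<in>?X. \<mu> r * inverse (\<nu> r)) = (\<Sum>r\<in>?R. (\<Sum>\<mu>\<in>?X. \<mu> r) * inverse (\<nu> r))"
    by (simp only: sum_distrib_right)
  also have "\<dots> = (\<Sum>r\<in>?R. if r = \<one> then of_nat (card (carrier G)) else 0)"
    using R baer.sum_linear_characters_eq fin baer_character_one[OF \<nu>]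
    by (intro sum.cong refl) (auto simp: subset_iff)
  also have "\<dots> = of_nat (card (carrier G))"
    using one finite_subset[OF R fin] by simp
  finally have "of_nat (card ?F * card ?R) = (of_nat (card (carrier G)) :: complex)"
    using 1 by (subst (asm) sum.swap) simp
  then show ?thesis by (simp only: of_nat_eq_iff)
qed

text \<open>Commutators are central and so lie in the radical of \<open>\<nu>\<close>; the two
  bicharacters therefore coincide.\<close>

lemma radical_cong:
  assumes \<mu>: "linear_character baer \<mu>" and \<nu>: "linear_character baer \<nu>"
    and eq: "\<And>r. r \<in> radical \<nu> \<Longrightarrow> \<mu> r = \<nu> r"
  shows "radical \<mu> = radical \<nu>"
  using eq[OF central_in_radical[OF \<nu> central_commutator]] by (auto simp: radical_def)

lemma is_character_word_count:
  assumes p: "prime p" and card: "card (carrier G) = p ^ e" and k: "k \<ge> 1"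
    and w: "w \<in> carrier (free_group k)"
  shows "is_character G (\<lambda>g. of_nat (word_count G k w g))"
proof -
  define n where "n = card (carrier G)"
  define X where "X = linear_characters baer"
  define N :: "'a \<Rightarrow> complex" where "N x = of_nat (word_count G k w x)" for x
  have finX: "finite X" using baer.finite_linear_characters fin by (simp add: X_def)
  have lin: "linear_character baer \<nu>" if "\<nu> \<in> X" for \<nu>
    using that by (simp add: X_def linear_characters_def)
  have n0: "n > 0" using card_pos by (simp add: n_def)
  have w_letters: "fst ` set w \<subseteq> {..<k}" using w by (simp add: free_group_def)
  have N_conj: "N (x \<otimes> g \<otimes> inv x) = N g" if "x \<in> carrier G" "g \<in> carrier G" for x g
    using word_count_conj[OF that w] by (simp add: N_def)
  have "\<forall>\<nu>\<in>X. \<exists>d. d * d * card (radical \<nu>) = n \<and>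
     (\<lambda>g\<in>carrier G. if g \<in> radical \<nu> then of_nat d * \<nu> g else 0) \<in> irr_characters G"
    using ex_irreducible_character[OF lin] by (simp add: n_def)
  then obtain d where d: "\<And>\<nu>. \<nu> \<in> X \<Longrightarrow> d \<nu> * d \<nu> * card (radical \<nu>) = n"
    and irr: "\<And>\<nu>. \<nu> \<in> X \<Longrightarrow>
      (\<lambda>g\<in>carrier G. if g \<in> radical \<nu> then of_nat (d \<nu>) * \<nu> g else 0) \<in> irr_characters G"
    by (fastforce dest: bchoice)
  define \<Psi> where "\<Psi> \<nu> = (\<lambda>g\<in>carrier G. if g \<in> radical \<nu> then of_nat (d \<nu>) * \<nu> g else 0)" for \<nu>
  \<comment> \<open>The coefficient lemma is applied to the inverse of \<open>\<nu>\<close>, which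
    makes \<open>c \<nu>\<close> the Fourier coefficient at \<open>\<nu>\<close>.\<close>
  have "\<forall>\<nu>\<in>X. \<exists>m. (\<Sum>x\<in>carrier G. N x * inverse (\<nu> x)) = of_nat (n * m)"
    using word_count_coefficient[OF p card k w_letters linear_character_inverse[OF lin]]
    by (simp add: N_def n_def)
  then obtain c where c: "\<And>\<nu>. \<nu> \<in> X \<Longrightarrow> (\<Sum>x\<in>carrier G. N x * inverse (\<nu> x)) = of_nat (n * c \<nu>)"
    by (fastforce dest: bchoice)
  \<comment> \<open>This is the Fourier term of \<open>\<nu>\<close> averaged over
    conjugation.\<close>
  define f where "f \<nu> g = of_nat (c \<nu>) * (if g \<in> radical \<nu> then \<nu> g else 0)" for \<nu> and g :: 'a
  have N_fourier: "N g = (\<Sum>\<nu>\<in>X. of_nat (c \<nu>) * \<nu> g)" if g: "g \<in> carrier G" for g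
  proof -
    have "N g = (\<Sum>\<nu>\<in>X. (\<Sum>y\<in>carrier G. N y * inverse (\<nu> y)) / of_nat n * \<nu> g)"
      using baer.fourier_inversion[of g N] fin g by (simp add: X_def n_def)
    also have "\<dots> = (\<Sum>\<nu>\<in>X. of_nat (c \<nu>) * \<nu> g)"
      using n0 by (intro sum.cong refl) (simp add: c)
    finally show ?thesis .
  qed
  have N_f: "N g = (\<Sum>\<nu>\<in>X. f \<nu> g)" if g: "g \<in> carrier G" for g
  proof -
    have "of_nat n * N g = (\<Sum>x\<in>carrier G. N (x \<otimes> g \<otimes> inv x))"
      using g by (simp add: N_conj n_def)
    also have "\<dots> = (\<Sum>x\<in>carrier G. \<Sum>\<nu>\<in>X. of_nat (c \<nu>) * \<nu> g * \<nu> (commutator x g))"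
      using g by (intro sum.cong refl) (simp add: N_fourier baer_character_conj[OF lin] mult_ac)
    also have "\<dots> = (\<Sum>\<nu>\<in>X. of_nat (c \<nu>) * \<nu> g * (\<Sum>x\<in>carrier G. \<nu> (commutator x g)))"
      by (subst sum.swap) (simp only: sum_distrib_left)
    also have "\<dots> = (\<Sum>\<nu>\<in>X. of_nat n * f \<nu> g)"
      using g by (intro sum.cong refl) (simp add: sum_commutator[OF lin] f_def n_def)
    also have "\<dots> = of_nat n * (\<Sum>\<nu>\<in>X. f \<nu> g)" by (simp only: sum_distrib_left)
    finally show ?thesis using n0 by simp
  qed
  have radical_sub: "radical \<nu> \<subseteq> carrier G" for \<nu> by (auto simp: radical_def)
  have d0: "d \<nu> > 0" and card_radical: "card (radical \<nu>) > 0" if "\<nu> \<in> X" for \<nu>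
    using d[OF that] n0 by (auto intro: gr0I)
  \<comment> \<open>The value of \<open>\<Psi> \<nu>\<close> at the identity is
    \<open>d \<nu>\<close>, after which \<open>\<nu>\<close> on its radical can be read off.
    Conversely, the restriction determines the radical and the order of the radical determines
    \<open>d\<close>.\<close>
  have \<Psi>_eq: "\<Psi> \<mu> = \<Psi> \<nu> \<longleftrightarrow> (\<forall>r\<in>radical \<nu>. \<mu> r = \<nu> r)" if \<mu>: "\<mu> \<in> X" and \<nu>: "\<nu> \<in> X" for \<mu> \<nu>
  proof
    assume eq: "\<Psi> \<mu> = \<Psi> \<nu>"
    have "\<Psi> \<mu> \<one> = of_nat (d \<mu>)" "\<Psi> \<nu> \<one> = of_nat (d \<nu>)"
      using central_in_radical[OF lin central_one] \<mu> \<nu> baer_character_one[OF lin]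
      by (simp_all add: \<Psi>_def)
    then have dd: "d \<mu> = d \<nu>" using eq by simp
    show "\<forall>r\<in>radical \<nu>. \<mu> r = \<nu> r"
    proof
      fix r assume r: "r \<in> radical \<nu>"
      then have rG: "r \<in> carrier G" using radical_sub by auto
      have "\<Psi> \<mu> r = of_nat (d \<nu>) * \<nu> r" using r rG eq by (simp add: \<Psi>_def)
      moreover have "of_nat (d \<nu>) * \<nu> r \<noteq> 0" using d0[OF \<nu>] baer_character_nonzero[OF lin[OF \<nu>] rG] by simp
      ultimately show "\<mu> r = \<nu> r" using rG dd by (auto simp: \<Psi>_def split: if_splits)
    qed
  next
    assume eq: "\<forall>r\<in>radical \<nu>. \<mu> r = \<nu> r"
    have rad: "radical \<mu> = radical \<nu>"
      using eq by (intro radical_cong lin \<mu> \<nu>) auto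
    have "d \<mu> * d \<mu> * card (radical \<nu>) = d \<nu> * d \<nu> * card (radical \<nu>)"
      using d[OF \<mu>] d[OF \<nu>] rad by simp
    then have "(d \<mu>)\<^sup>2 = (d \<nu>)\<^sup>2" using card_radical[OF \<nu>] by (simp add: power2_eq_square)
    then have "d \<mu> = d \<nu>" by (simp add: power2_eq_iff_nonneg)
    then show "\<Psi> \<mu> = \<Psi> \<nu>" unfolding \<Psi>_def using eq rad by (intro restrict_ext) auto
  qed
  have f_eq: "f \<mu> g = f \<nu> g" if \<mu>: "\<mu> \<in> X" and \<nu>: "\<nu> \<in> X" and eq: "\<Psi> \<mu> = \<Psi> \<nu>" for \<mu> \<nu> g
  proof -
    have agree: "\<And>r. r \<in> radical \<nu> \<Longrightarrow> \<mu> r = \<nu> r" using \<Psi>_eq[OF \<mu> \<nu>] eq by auto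
    have rad: "radical \<mu> = radical \<nu>"
      using agree by (intro radical_cong lin \<mu> \<nu>) auto
    \<comment> \<open>As \<open>N\<close> is a class function, its coefficient can be computed on
      the radical, where \<open>\<mu>\<close> and \<open>\<nu>\<close> agree.\<close>
    have coeff: "of_nat (n * c \<kappa>) = (\<Sum>y\<in>radical \<kappa>. N y * inverse (\<kappa> y))" if "\<kappa> \<in> X" for \<kappa>
      using sum_class_function[OF linear_character_inverse[OF lin[OF that]], of N] N_conj
      by (simp only: c[OF that, symmetric] radical_inverse)
    have "(of_nat (n * c \<mu>) :: complex) = of_nat (n * c \<nu>)"
      unfolding coeff[OF \<mu>] coeff[OF \<nu>] rad using agree by (intro sum.cong refl) simp
    then have "c \<mu> = c \<nu>" using n0 by (simp only: of_nat_eq_iff) simp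
    then show ?thesis using rad agree by (auto simp: f_def)
  qed
  define r where "r = inv_into X \<Psi>"
  have r: "r \<chi> \<in> X" "\<Psi> (r \<chi>) = \<chi>" if "\<chi> \<in> \<Psi> ` X" for \<chi>
    using that by (auto simp: r_def inv_into_into f_inv_into_f)
  have "N g = (\<Sum>\<chi>\<in>\<Psi> ` X. of_nat (d (r \<chi>) * c (r \<chi>)) * \<chi> g)" if g: "g \<in> carrier G" for g
  proof -
    have "N g = (\<Sum>\<chi>\<in>\<Psi> ` X. \<Sum>\<nu>\<in>{\<nu> \<in> X. \<Psi> \<nu> = \<chi>}. f \<nu> g)"
      unfolding N_f[OF g] by (rule sum.image_gen[OF finX])
    also have "\<dots> = (\<Sum>\<chi>\<in>\<Psi> ` X. of_nat (d (r \<chi>) * c (r \<chi>)) * \<chi> g)"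
    proof (rule sum.cong[OF refl])
      fix \<chi> assume \<chi>: "\<chi> \<in> \<Psi> ` X"
      note r\<chi> = r[OF \<chi>]
      let ?\<nu> = "r \<chi>"
      have "{\<nu> \<in> X. \<Psi> \<nu> = \<chi>} = {\<nu> \<in> X. \<forall>s\<in>radical ?\<nu>. \<nu> s = ?\<nu> s}"
        using \<Psi>_eq[OF _ r\<chi>(1)] r\<chi>(2) by auto
      then have "card {\<nu> \<in> X. \<Psi> \<nu> = \<chi>} * card (radical ?\<nu>) = d ?\<nu> * d ?\<nu> * card (radical ?\<nu>)"
        using card_extensions[OF lin[OF r\<chi>(1)]] d[OF r\<chi>(1)] by (simp add: X_def n_def)
      then have card_fibre: "card {\<nu> \<in> X. \<Psi> \<nu> = \<chi>} = d ?\<nu> * d ?\<nu>"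
        using card_radical[OF r\<chi>(1)] by simp
      have "(\<Sum>\<nu>\<in>{\<nu> \<in> X. \<Psi> \<nu> = \<chi>}. f \<nu> g) = (\<Sum>\<nu>\<in>{\<nu> \<in> X. \<Psi> \<nu> = \<chi>}. f ?\<nu> g)"
        using r\<chi> by (intro sum.cong refl f_eq) auto
      also have "\<dots> = of_nat (d ?\<nu> * d ?\<nu>) * f ?\<nu> g" by (simp add: card_fibre)
      \<comment> \<open>One of the two factors \<open>d\<close> from the size of the fibre is
        absorbed into \<open>\<Psi>\<close>, leaving the multiplicity \<open>d * c\<close>.\<close>
      also have "\<dots> = of_nat (d ?\<nu> * c ?\<nu>) * \<Psi> ?\<nu> g" using g by (simp add: f_def \<Psi>_def)
      finally show "(\<Sum>\<nu>\<in>{\<nu> \<in> X. \<Psi> \<nu> = \<chi>}. f \<nu> g) = of_nat (d ?\<nu> * c ?\<nu>) * \<chi> g"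
        by (simp only: r\<chi>(2))
    qed
    finally show ?thesis .
  qed
  moreover have "\<Psi> ` X \<subseteq> irr_characters G" using irr by (auto simp: \<Psi>_def)
  ultimately show ?thesis
    unfolding is_character_def N_def
    by (intro exI[of _ "\<Psi> ` X"] exI[of _ "\<lambda>\<chi>. d (r \<chi>) * c (r \<chi>)"]) (use finX in simp)
qed

end

section \<open>From nilpotency class two to central commutators\<close>

theorem theorem4p3:
  fixes G :: "('a, 'b) monoid_scheme" and p k :: nat and w :: "letter list"
  assumes "prime p" and "odd p"
    and "group G" and "finite (carrier G)" and "\<exists>n. Coset.order G = p ^ n"
    and "has_nilpotency_class G 2"
    and "k \<ge> 1" and "w \<in> carrier (free_group k)"
  shows "is_character G (\<lambda>g. of_nat (word_count G k w g))"
proof -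
  interpret group G by (rule assms)
  obtain e where e: "card (carrier G) = p ^ e" using assms(5) by (auto simp: Coset.order_def)
  have "odd_class_two_group G"
  proof
    show "finite (carrier G)" by (rule assms)
    show "odd (card (carrier G))" using \<open>odd p\<close> e by simp
    fix x y z assume xyz: "x \<in> carrier G" "y \<in> carrier G" "z \<in> carrier G"
    let ?c = "x \<otimes>\<^bsub>G\<^esub> y \<otimes>\<^bsub>G\<^esub> inv\<^bsub>G\<^esub> x \<otimes>\<^bsub>G\<^esub> inv\<^bsub>G\<^esub> y"
    \<comment> \<open>The term of index 1 contains the commutators, and class two makes the term of
      index 2 trivial; hence the commutator of \<open>?c\<close> with \<open>z\<close> is
      trivial.\<close>
    have "?c \<in> lower_central G (Suc 0)"
      using xyz by (auto intro!: generate.incl)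
    then have "?c \<otimes>\<^bsub>G\<^esub> z \<otimes>\<^bsub>G\<^esub> inv\<^bsub>G\<^esub> ?c \<otimes>\<^bsub>G\<^esub> inv\<^bsub>G\<^esub> z \<in> lower_central G (Suc (Suc 0))"
      using xyz unfolding lower_central.simps(2)[of G "Suc 0"] by (intro generate.incl) blast
    also have "lower_central G (Suc (Suc 0)) = {\<one>\<^bsub>G\<^esub>}"
      using assms(6) unfolding has_nilpotency_class_def numeral_2_eq_2 by blast
    finally have one: "?c \<otimes>\<^bsub>G\<^esub> z \<otimes>\<^bsub>G\<^esub> inv\<^bsub>G\<^esub> ?c \<otimes>\<^bsub>G\<^esub> inv\<^bsub>G\<^esub> z = \<one>\<^bsub>G\<^esub>" by simp
    have cG: "?c \<in> carrier G" using xyz by simp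
    have "?c \<otimes>\<^bsub>G\<^esub> z = ?c \<otimes>\<^bsub>G\<^esub> z \<otimes>\<^bsub>G\<^esub> inv\<^bsub>G\<^esub> ?c \<otimes>\<^bsub>G\<^esub> inv\<^bsub>G\<^esub> z \<otimes>\<^bsub>G\<^esub> (z \<otimes>\<^bsub>G\<^esub> ?c)"
    proof -
      have "c \<otimes>\<^bsub>G\<^esub> z \<otimes>\<^bsub>G\<^esub> inv\<^bsub>G\<^esub> c \<otimes>\<^bsub>G\<^esub> inv\<^bsub>G\<^esub> z \<otimes>\<^bsub>G\<^esub> (z \<otimes>\<^bsub>G\<^esub> c) = c \<otimes>\<^bsub>G\<^esub> z"
        if "c \<in> carrier G" for c
      proof -
        have "inv\<^bsub>G\<^esub> z \<otimes>\<^bsub>G\<^esub> (z \<otimes>\<^bsub>G\<^esub> c) = c" using that xyz by (simp flip: m_assoc)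
        then show ?thesis using that xyz by (simp add: m_assoc)
      qed
      from this[OF cG] show ?thesis by simp
    qed
    also have "\<dots> = z \<otimes>\<^bsub>G\<^esub> ?c" unfolding one using xyz cG by simp
    finally show "?c \<otimes>\<^bsub>G\<^esub> z = z \<otimes>\<^bsub>G\<^esub> ?c" .
  qed
  then show ?thesis
    using assms e by (intro odd_class_two_group.is_character_word_count)
qed

end
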